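(* Fix $r\in(0,\infty)$. Let $(s_n)_{n\ge1}$ be a sequence of positive integers with $s_n\le n$, and put $\eta_n=s_n/n$. Suppose $s_n\to\infty$ and $s_n/n\to0$ as $n\to\infty$. Let $\pi_n^{\mathrm{IID}}$ be the prior on $\mathbb{R}^n$ under which $\theta_1,\dots,\theta_n$ are i.i.d. with law $(1-\eta_n)\delta_0+\eta_n\delta_{\lambda_f}$, where $\lambda_f=\sqrt{v_w}\,\lambda_e$, $\lambda_e=\sqrt{2\log(\eta_n^{-1}(1-\eta_n))}$ and $v_w=(1+r^{-1})^{-1}$. Then $$B(\pi_n^{\mathrm{IID}})=R_N(\Theta_n[s_n])\,(1+o(1))\qquad\text{as } n\to\infty.$$
   Context: Model: for $\theta\in\mathbb{R}^n$, the past observation $X\sim N_n(\theta,I)$ and the future observation $Y\sim N_n(\theta,rI)$ are independent given $\theta$; $r>0$ is known and fixed. Write $p(x|\theta,1)$ and $p(y|\theta,r)$ for their densities. A predictive density estimator is a measurable $\hat p(y|x)$ such that $\hat p(\cdot|x)$ is a probability density on $\mathbb{R}^n$ for each $x\in\mathbb{R}^n$. Its Kullback--Leibler loss is $L(\theta,\hat p(\cdot|x))=\int p(y|\theta,r)\log\frac{p(y|\theta,r)}{\hat p(y|x)}\,dy$ and its risk is $\rho(\theta,\hat p)=\int L(\theta,\hat p(\cdot|x))\,p(x|\theta,1)\,dx$. Parameter space: $\Theta_n[s]=\{\theta\in\mathbb{R}^n:\#\{i:\theta_i\ne0\}\le s\}$. Minimax risk: $R_N(\Theta)=\inf_{\hat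 p}\sup_{\theta\in\Theta}\rho(\theta,\hat p)$. For a prior probability measure $\pi$ on $\mathbb{R}^n$, the integrated risk is $B(\pi,\hat p)=\int\rho(\theta,\hat p)\,\pi(d\theta)$ and the Bayes risk is $B(\pi)=\inf_{\hat p}B(\pi,\hat p)$. All infima are over all predictive density estimators. $\delta_\lambda$ is the unit point mass at $\lambda$. (The definitions of $\lambda_e,\lambda_f$ make sense for $\eta_n<1/2$, i.e. for all large $n$.) *)

theory Defs
  imports "HOL-Probability.Probability"
begin

text \<open>
  Points of \<open>\<real>\<^sup>n\<close> are the extensional functions in \<open>{..<n} \<rightarrow>\<^sub>E UNIV\<close>, because the dimension varies
  inside the main statement.
\<close>

abbreviation Rn :: "nat \<Rightarrow> (nat \<Rightarrow> real) set" where
  "Rn n \<equiv> {..<n} \<rightarrow>\<^sub>E UNIV"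

abbreviation lborel_n :: "nat \<Rightarrow> (nat \<Rightarrow> real) measure" where
  "lborel_n n \<equiv> Pi\<^sub>M {..<n} (\<lambda>_. lborel)"

text \<open>
  The integral of an extended-real function as the integral of the positive part minus that of the
  negative part (\<^const>\<open>e2ennreal\<close> sends negative numbers to 0). The Bochner integral, and hence the
  library's \<^const>\<open>KL_divergence\<close>, would be 0 where the divergence is infinite.
\<close>

definition ext_integral :: "'a measure \<Rightarrow> ('a \<Rightarrow> ereal) \<Rightarrow> ereal" where
  "ext_integral M f =
     enn2ereal (\<integral>\<^sup>+ x. e2ennreal (f x) \<partial>M) - enn2ereal (\<integral>\<^sup>+ x. e2ennreal (- f x) \<partial>M)"

text \<open>The density of \<open>N\<^sub>n(\<theta>, v I)\<close>; \<^const>\<open>normal_density\<close> takes the standard deviation.\<close>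

definition gauss_density :: "nat \<Rightarrow> real \<Rightarrow> (nat \<Rightarrow> real) \<Rightarrow> (nat \<Rightarrow> real) \<Rightarrow> real" where
  "gauss_density n v \<theta> x = (\<Prod>i<n. normal_density (\<theta> i) (sqrt v) (x i))"

text \<open>The first argument of an estimator is the past observation \<open>x\<close>, the second one is \<open>y\<close>.\<close>

definition pred_estimators :: "nat \<Rightarrow> ((nat \<Rightarrow> real) \<Rightarrow> (nat \<Rightarrow> real) \<Rightarrow> real) set" where
  "pred_estimators n =
     {q. case_prod q \<in> borel_measurable (lborel_n n \<Otimes>\<^sub>M lborel_n n) \<and>
         (\<forall>x\<in>Rn n. (\<forall>y\<in>Rn n. 0 \<le> q x y) \<and> (\<integral>\<^sup>+ y. ennreal (q x y) \<partial>lborel_n n) = 1)}"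

text \<open>
  Where the predictive density \<open>q\<close> vanishes the integrand is \<open>\<infinity>\<close>, since the Gaussian density \<open>p\<close> is
  positive everywhere. As \<open>p * ln (p / q) \<ge> p - q\<close>, the negative part of the integrand has integral
  at most 1, so no \<open>\<infinity> - \<infinity>\<close> occurs.
\<close>

definition kl_loss :: "nat \<Rightarrow> real \<Rightarrow> (nat \<Rightarrow> real) \<Rightarrow> ((nat \<Rightarrow> real) \<Rightarrow> real) \<Rightarrow> ereal" where
  "kl_loss n r \<theta> q =
     ext_integral (lborel_n n)
       (\<lambda>y. if q y = 0 then \<infinity>
            else ereal (gauss_density n r \<theta> y * ln (gauss_density n r \<theta> y / q y)))"

definition kl_risk ::
  "nat \<Rightarrow> real \<Rightarrow> (nat \<Rightarrow> real) \<Rightarrow> ((nat \<Rightarrow> real) \<Rightarrow> (nat \<Rightarrow> real) \<Rightarrow> real) \<Rightarrow> ereal" where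
  "kl_risk n r \<theta> q =
     ext_integral (lborel_n n) (\<lambda>x. kl_loss n r \<theta> (q x) * ereal (gauss_density n 1 \<theta> x))"

definition sparse_params :: "nat \<Rightarrow> nat \<Rightarrow> (nat \<Rightarrow> real) set" where
  "sparse_params n s = {\<theta> \<in> Rn n. card {i. i < n \<and> \<theta> i \<noteq> 0} \<le> s}"

definition minimax_risk :: "nat \<Rightarrow> real \<Rightarrow> (nat \<Rightarrow> real) set \<Rightarrow> ereal" where
  "minimax_risk n r \<Theta> = (INF q\<in>pred_estimators n. SUP \<theta>\<in>\<Theta>. kl_risk n r \<theta> q)"

definition integrated_risk ::
  "nat \<Rightarrow> real \<Rightarrow> (nat \<Rightarrow> real) measure \<Rightarrow> ((nat \<Rightarrow> real) \<Rightarrow> (nat \<Rightarrow> real) \<Rightarrow> real) \<Rightarrow> ereal" where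
  "integrated_risk n r \<pi> q = ext_integral \<pi> (\<lambda>\<theta>. kl_risk n r \<theta> q)"

definition bayes_risk :: "nat \<Rightarrow> real \<Rightarrow> (nat \<Rightarrow> real) measure \<Rightarrow> ereal" where
  "bayes_risk n r \<pi> = (INF q\<in>pred_estimators n. integrated_risk n r \<pi> q)"

definition v_w :: "real \<Rightarrow> real" where
  "v_w r = inverse (1 + inverse r)"

definition lambda_e :: "real \<Rightarrow> real" where
  "lambda_e \<eta> = sqrt (2 * ln (inverse \<eta> * (1 - \<eta>)))"

definition lambda_f :: "real \<Rightarrow> real \<Rightarrow> real" where
  "lambda_f r \<eta> = sqrt (v_w r) * lambda_e \<eta>"

definition two_point_law :: "real \<Rightarrow> real \<Rightarrow> real measure" where
  "two_point_law \<eta> l = distr (measure_pmf (bernoulli_pmf \<eta>)) borel (\<lambda>b. if b then l else 0)"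

lemma emeasure_two_point_law:
  assumes "0 \<le> \<eta>" "\<eta> \<le> 1" "A \<in> sets borel"
  shows "emeasure (two_point_law \<eta> l) A = ennreal (1 - \<eta>) * indicator A 0 + ennreal \<eta> * indicator A l"
  using assms
  by (simp add: two_point_law_def nn_integral_indicator[symmetric] nn_integral_distr
      del: nn_integral_indicator)
    (simp add: nn_integral_measure_pmf nn_integral_count_space_finite UNIV_bool
      mult.commute indicator_def)

definition iid_prior :: "nat \<Rightarrow> real \<Rightarrow> real \<Rightarrow> (nat \<Rightarrow> real) measure" where
  "iid_prior n r \<eta> = Pi\<^sub>M {..<n} (\<lambda>_. two_point_law \<eta> (lambda_f r \<eta>))"

end

theory Submission
  imports Defs
begin

text \<open>
  Let \<open>L = log ((1 - \<eta>) / \<eta>)\<close> with \<open>\<eta> = s / n\<close>. Both risks are squeezed between \<open>1 + o(1)\<close> multiples of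
  \<open>A = s L / (1 + r)\<close>, which is at once the worst cost of predicting \<open>s\<close> unknown spikes and the
  cost of \<open>s\<close> spikes placed at \<open>\<lambda>\<^sub>f\<close>.

  Upper bound. One product estimator serves both risks. In each coordinate it mixes \<open>N(0, r)\<close>, the
  prediction for a null coordinate, with \<open>N(x, 1 + r)\<close>, the prediction under a flat prior; the log
  odds of the first against the second are \<open>L - x\<^sup>2 / 2\<close>. At \<open>\<theta>\<^sub>i = t\<close> the first component
  bounds the loss by about \<open>t\<^sup>2 / (2 r)\<close> and the second by about \<open>L - t\<^sup>2 / 2\<close>. The average of the two
  bounds with weights \<open>r / (1 + r)\<close> and \<open>1 / (1 + r)\<close> is \<open>L / (1 + r)\<close>, whatever \<open>t\<close> is
  (\<open>spike_slab_risk_le\<close>). At \<open>t = 0\<close> the risk is only of order \<open>\<eta> \<surd>L\<close>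
  (\<open>spike_slab_risk_zero\<close>), so that the \<open>n - s\<close> null coordinates together contribute \<open>o(A)\<close>.

  Lower bound. For any estimator \<open>q\<close> and any positive comparator \<open>b\<close>, \<open>ln (p / q) \<ge> ln (p / b) + 1 - q / b\<close>.
  Take for \<open>b\<close> the Bayes predictive density of the two-point prior. It is a product, hence
  \<open>ln (p / b)\<close> is a sum over coordinates; and \<open>q / b\<close> has expectation one under the mixture of all
  sparse models, whatever \<open>q\<close> is (\<open>kl_risk_spike_vector_ge\<close>). At a spike the height \<open>\<lambda>\<^sub>f\<close> is exactly
  such that the pair of past and future observation carries a log likelihood ratio with mean \<open>L\<close>. It only just
  cancels the prior odds against a spike, so that the cost \<open>\<lambda>\<^sub>f\<^sup>2 / (2 r) = L / (1 + r)\<close> of predicting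
  with \<open>N(0, r)\<close> is lost up to \<open>O(\<surd>L)\<close> (\<open>bayes_predictor_risk_spike_ge\<close>). Averaging over the prior
  bounds the Bayes risk from below. The prior is not carried by the sparse vectors, so for the
  minimax risk the same inequality is averaged only over supports of size at most \<open>s\<close>, under a
  prior with slightly smaller \<open>\<eta>\<close>. Chebyshev's inequality controls the
  mass that is cut off (\<open>truncated_mean_ge\<close>); this is where \<open>s \<longrightarrow> \<infinity>\<close> is used.
\<close>

section \<open>Extended integrals and Gaussian products\<close>

text \<open>
  As \<open>\<infinity> - \<infinity>\<close> is \<open>\<infinity>\<close> in the extended reals, subtraction is monotone there even at the infinite
  values. Every risk below is therefore compared
  with an integrable function instead of being computed.
\<close>

lemma ext_integral_mono_AE:
  assumes "AE x in M. f x \<le> g x"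
  shows "ext_integral M f \<le> ext_integral M g"
  unfolding ext_integral_def
proof (rule ereal_minus_mono)
  show "enn2ereal (\<integral>\<^sup>+ x. e2ennreal (f x) \<partial>M) \<le> enn2ereal (\<integral>\<^sup>+ x. e2ennreal (g x) \<partial>M)"
    using assms unfolding less_eq_ennreal.rep_eq[symmetric]
    by (intro nn_integral_mono_AE) (auto intro!: e2ennreal_mono elim!: eventually_mono)
  show "enn2ereal (\<integral>\<^sup>+ x. e2ennreal (- g x) \<partial>M) \<le> enn2ereal (\<integral>\<^sup>+ x. e2ennreal (- f x) \<partial>M)"
    using assms unfolding less_eq_ennreal.rep_eq[symmetric]
    by (intro nn_integral_mono_AE) (auto intro!: e2ennreal_mono elim!: eventually_mono)
qed

lemma ext_integral_has_bochner_integral: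
  assumes "has_bochner_integral M f c"
  shows "ext_integral M (\<lambda>x. ereal (f x)) = ereal c"
proof -
  have f: "integrable M f" and c: "integral\<^sup>L M f = c"
    using assms by (auto simp: has_bochner_integral_iff)
  obtain a b where "0 \<le> a" "0 \<le> b" "(\<integral>\<^sup>+ x. ennreal (f x) \<partial>M) = ennreal a"
    "(\<integral>\<^sup>+ x. ennreal (- f x) \<partial>M) = ennreal b"
    using f unfolding real_integrable_def
    by (cases "\<integral>\<^sup>+ x. ennreal (f x) \<partial>M"; cases "\<integral>\<^sup>+ x. ennreal (- f x) \<partial>M") auto
  then show ?thesis
    using real_lebesgue_integral_def[OF f] c by (simp add: ext_integral_def)
qed

lemma ext_integral_le:
  assumes "\<And>x. x \<in> space M \<Longrightarrow> f x \<le> ereal (g x)" "has_bochner_integral M g c"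
  shows "ext_integral M f \<le> ereal c"
  unfolding ext_integral_has_bochner_integral[OF assms(2), symmetric]
  by (intro ext_integral_mono_AE AE_I2 assms(1))

lemma le_ext_integral:
  assumes "\<And>x. x \<in> space M \<Longrightarrow> ereal (g x) \<le> f x" "has_bochner_integral M g c"
  shows "ereal c \<le> ext_integral M f"
  unfolding ext_integral_has_bochner_integral[OF assms(2), symmetric]
  by (intro ext_integral_mono_AE AE_I2 assms(1))

lemma product_sigma_finite_lborel: "product_sigma_finite (\<lambda>_. lborel :: real measure)"
  by (simp add: product_sigma_finite_def lborel.sigma_finite_measure_axioms)

lemma sigma_finite_lborel_n: "sigma_finite_measure (lborel_n n)"
  by (rule product_sigma_finite.sigma_finite[OF product_sigma_finite_lborel]) simp

lemma gauss_density_pos: "0 < v \<Longrightarrow> 0 < gauss_density n v \<theta> x"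
  by (auto simp: gauss_density_def intro!: prod_pos normal_density_pos)

lemma gauss_density_measurable [measurable]:
  "gauss_density n v \<theta> \<in> borel_measurable (lborel_n n)"
  unfolding gauss_density_def by measurable

lemma has_bochner_integral_prod:
  assumes "\<And>i. i < n \<Longrightarrow> has_bochner_integral lborel (f i) (c i :: real)"
  shows "has_bochner_integral (lborel_n n) (\<lambda>x. \<Prod>i<n. f i (x i)) (\<Prod>i<n. c i)"
proof -
  interpret product_sigma_finite "\<lambda>_::nat. lborel :: real measure"
    by (rule product_sigma_finite_lborel)
  have "integrable (lborel_n n) (\<lambda>x. \<Prod>i<n. f i (x i))"
    using assms by (intro product_integrable_prod) (auto simp: has_bochner_integral_iff)
  moreover have "integral\<^sup>L (lborel_n n) (\<lambda>x. \<Prod>i<n. f i (x i)) = (\<Prod>i<n. c i)"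
    using assms by (subst product_integral_prod) (auto simp: has_bochner_integral_iff)
  ultimately show ?thesis by (simp add: has_bochner_integral_iff)
qed

text \<open>
  Most of the loss bounds below are made quadratic in the centred observation, so that this lemma
  integrates them.
\<close>

lemma normal_density_moments:
  assumes "0 < v"
  shows "has_bochner_integral lborel
    (\<lambda>x. normal_density t (sqrt v) x * (a + b * (x - t) + c * (x - t)\<^sup>2)) (a + c * v)"
proof -
  have s: "0 < sqrt v" using assms by simp
  note e = normal_moment_even[OF s, of t 0] normal_moment_odd[OF s, of t 0]
    normal_moment_even[OF s, of t 1]
  have "has_bochner_integral lborel
     (\<lambda>x. normal_density t (sqrt v) x * (x - t) ^ (2*0) * a
        + normal_density t (sqrt v) x * (x - t) ^ (2 * 0 + 1) * b
        + normal_density t (sqrt v) x * (x - t) ^ (2*1) * c)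
     (fact (2*0) / ((2 / (sqrt v)\<^sup>2) ^ 0 * fact 0) * a + 0 * b
       + fact (2*1) / ((2 / (sqrt v)\<^sup>2) ^ 1 * fact 1) * c)"
    by (intro has_bochner_integral_add has_bochner_integral_mult_left e)
  then show ?thesis
    by (rule back_subst[where P = "\<lambda>z. z"])
       (use assms in \<open>intro arg_cong2[where f = "has_bochner_integral lborel"] ext;
          simp add: algebra_simps power2_eq_square\<close>)
qed

lemma normal_density_integral:
  "0 < v \<Longrightarrow> has_bochner_integral lborel (normal_density t (sqrt v)) 1"
  by (simp add: has_bochner_integral_iff)

lemma gauss_density_integral:
  assumes "0 < v"
  shows "has_bochner_integral (lborel_n n) (gauss_density n v \<theta>) 1"
  using has_bochner_integral_prod[of n "\<lambda>i. normal_density (\<theta> i) (sqrt v)" "\<lambda>_. 1"]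
    normal_density_integral[OF assms]
  by (simp add: gauss_density_def[abs_def])

text \<open>
  In the product measure the factors without \<open>f i\<close> integrate to one. This lemma turns bounds for
  single coordinates into bounds in dimension \<open>n\<close>.
\<close>

lemma gauss_density_integral_sum:
  assumes v: "0 < v"
    and f: "\<And>i. i < n \<Longrightarrow> has_bochner_integral lborel (\<lambda>t. normal_density (\<theta> i) (sqrt v) t * f i t) (c i)"
  shows "has_bochner_integral (lborel_n n)
    (\<lambda>x. gauss_density n v \<theta> x * (\<Sum>i<n. f i (x i))) (\<Sum>i<n. c i)"
proof -
  have "has_bochner_integral (lborel_n n) (\<lambda>x. gauss_density n v \<theta> x * f k (x k)) (c k)"
    if k: "k < n" for k
  proof -
    let ?p = "\<lambda>i. normal_density (\<theta> i) (sqrt v)"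
    have "has_bochner_integral (lborel_n n)
        (\<lambda>x. \<Prod>i<n. ?p i (x i) * (if i = k then f i (x i) else 1)) (\<Prod>i<n. if i = k then c i else 1)"
      by (rule has_bochner_integral_prod[where f = "\<lambda>i t. ?p i t * (if i = k then f i t else 1)"])
         (use f normal_density_integral[OF v] in auto)
    with k show ?thesis
      by (simp add: prod.distrib gauss_density_def)
  qed
  then have "has_bochner_integral (lborel_n n)
      (\<lambda>x. \<Sum>i<n. gauss_density n v \<theta> x * f i (x i)) (\<Sum>i<n. c i)"
    by (intro has_bochner_integral_sum) auto
  then show ?thesis by (simp add: sum_distrib_left)
qed

section \<open>Tensorised upper bounds\<close>

definition product_predictor ::
  "nat \<Rightarrow> (real \<Rightarrow> real \<Rightarrow> real) \<Rightarrow> (nat \<Rightarrow> real) \<Rightarrow> (nat \<Rightarrow> real) \<Rightarrow> real" where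
  "product_predictor n q x y = (\<Prod>i<n. q (x i) (y i))"

lemma product_predictor_measurable:
  assumes [measurable]: "case_prod q \<in> borel_measurable (borel \<Otimes>\<^sub>M borel)"
  shows "case_prod (product_predictor n q) \<in> borel_measurable (lborel_n n \<Otimes>\<^sub>M lborel_n n)"
  unfolding product_predictor_def by measurable

lemma product_predictor_in_pred_estimators:
  assumes q: "case_prod q \<in> borel_measurable (borel \<Otimes>\<^sub>M borel)"
    and pos: "\<And>x y. 0 \<le> q x y"
    and int: "\<And>x. has_bochner_integral lborel (q x) 1"
  shows "product_predictor n q \<in> pred_estimators n"
proof -
  have "(\<integral>\<^sup>+ y. ennreal (product_predictor n q x y) \<partial>lborel_n n) = 1" for x
  proof -
    have b: "has_bochner_integral (lborel_n n) (product_predictor n q x) 1"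
      using has_bochner_integral_prod[of n "\<lambda>i. q (x i)" "\<lambda>_. 1"] int
      by (simp add: product_predictor_def[abs_def])
    have "0 \<le> product_predictor n q x y" for y
      by (simp add: product_predictor_def prod_nonneg pos)
    with b show ?thesis
      by (subst nn_integral_eq_integral) (auto simp: has_bochner_integral_iff)
  qed
  then show ?thesis
    by (auto simp: pred_estimators_def product_predictor_measurable[OF q])
       (simp add: product_predictor_def prod_nonneg pos)
qed

lemma ln_gauss_density_div_product_predictor:
  assumes "0 < v" "\<And>x y. 0 < q x y"
  shows "ln (gauss_density n v \<theta> y / product_predictor n q x y) =
    (\<Sum>i<n. ln (normal_density (\<theta> i) (sqrt v) (y i) / q (x i) (y i)))"
proof -
  have "normal_density (\<theta> i) (sqrt v) (y i) / q (x i) (y i) \<noteq> 0" for i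
    using assms(2)[of "x i" "y i"] normal_density_pos[of "sqrt v" "\<theta> i" "y i"] assms(1) by simp
  then show ?thesis
    unfolding gauss_density_def product_predictor_def prod_dividef[symmetric]
    by (intro ln_prod) auto
qed

text \<open>
  A certificate that the one-dimensional predictor \<open>q\<close> has risk at most \<open>U\<close> at \<open>t\<close>: the log
  likelihood ratio is dominated by an explicit function \<open>h\<close>, which is integrated over the future
  observation (giving \<open>H\<close>) and then over the past one. The integrals
  thus avoid the log ratio of the mixture, which has no closed form.
\<close>

definition coord_risk_le :: "real \<Rightarrow> (real \<Rightarrow> real \<Rightarrow> real) \<Rightarrow> real \<Rightarrow> real \<Rightarrow> bool" where
  "coord_risk_le r q t U \<longleftrightarrow> (\<exists>h H u.
     (\<forall>x y. ln (normal_density t (sqrt r) y / q x y) \<le> h x y) \<and>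
     (\<forall>x. has_bochner_integral lborel (\<lambda>y. normal_density t (sqrt r) y * h x y) (H x)) \<and>
     has_bochner_integral lborel (\<lambda>x. normal_density t 1 x * H x) u \<and> u \<le> U)"

lemma kl_risk_product_predictor_le:
  assumes r: "0 < r" and pos: "\<And>x y. 0 < q x y"
    and U: "\<And>i. i < n \<Longrightarrow> coord_risk_le r q (\<theta> i) (U i)"
  shows "kl_risk n r \<theta> (product_predictor n q) \<le> ereal (\<Sum>i<n. U i)"
proof -
  let ?q = "product_predictor n q"
  define ok where "ok i h H u \<longleftrightarrow>
     (\<forall>x y. ln (normal_density (\<theta> i) (sqrt r) y / q x y) \<le> h x y) \<and>
     (\<forall>x. has_bochner_integral lborel (\<lambda>y. normal_density (\<theta> i) (sqrt r) y * h x y) (H x)) \<and>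
     has_bochner_integral lborel (\<lambda>x. normal_density (\<theta> i) 1 x * H x) u \<and> u \<le> U i" for i h H u
  have "\<forall>i. \<exists>h H u. i < n \<longrightarrow> ok i h H u"
    using U unfolding coord_risk_le_def ok_def by blast
  then obtain h H u where ok: "\<And>i. i < n \<Longrightarrow> ok i (h i) (H i) (u i)" by metis
  have
    h: "\<And>i x y. i < n \<Longrightarrow> ln (normal_density (\<theta> i) (sqrt r) y / q x y) \<le> h i x y" and
    H: "\<And>i x. i < n \<Longrightarrow>
      has_bochner_integral lborel (\<lambda>y. normal_density (\<theta> i) (sqrt r) y * h i x y) (H i x)" and
    I: "\<And>i. i < n \<Longrightarrow> has_bochner_integral lborel (\<lambda>x. normal_density (\<theta> i) 1 x * H i x) (u i)" and
    u: "\<And>i. i < n \<Longrightarrow> u i \<le> U i"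
    using ok unfolding ok_def by blast+
  have loss: "kl_loss n r \<theta> (?q x) \<le> ereal (\<Sum>i<n. H i (x i))" for x
    unfolding kl_loss_def
  proof (rule ext_integral_le)
    show "has_bochner_integral (lborel_n n)
      (\<lambda>y. gauss_density n r \<theta> y * (\<Sum>i<n. h i (x i) (y i))) (\<Sum>i<n. H i (x i))"
      by (intro gauss_density_integral_sum r H)
    fix y
    have "0 < ?q x y" using pos by (simp add: product_predictor_def prod_pos)
    moreover have "ln (gauss_density n r \<theta> y / ?q x y) \<le> (\<Sum>i<n. h i (x i) (y i))"
      unfolding ln_gauss_density_div_product_predictor[of r q, OF r pos]
      by (intro sum_mono h) simp
    ultimately show "(if ?q x y = 0 then \<infinity>
        else ereal (gauss_density n r \<theta> y * ln (gauss_density n r \<theta> y / ?q x y)))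
      \<le> ereal (gauss_density n r \<theta> y * (\<Sum>i<n. h i (x i) (y i)))"
      using gauss_density_pos[OF r, of n \<theta> y] by (simp add: mult_left_mono)
  qed
  have "kl_risk n r \<theta> ?q \<le> ereal (\<Sum>i<n. u i)"
    unfolding kl_risk_def
  proof (rule ext_integral_le)
    show "has_bochner_integral (lborel_n n)
      (\<lambda>x. gauss_density n 1 \<theta> x * (\<Sum>i<n. H i (x i))) (\<Sum>i<n. u i)"
      using I by (intro gauss_density_integral_sum) auto
    fix x
    have "kl_loss n r \<theta> (?q x) * ereal (gauss_density n 1 \<theta> x) \<le>
        ereal (\<Sum>i<n. H i (x i)) * ereal (gauss_density n 1 \<theta> x)"
      using gauss_density_pos[of 1 n \<theta> x] by (intro ereal_mult_right_mono loss) simp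
    then show "kl_loss n r \<theta> (?q x) * ereal (gauss_density n 1 \<theta> x) \<le>
        ereal (gauss_density n 1 \<theta> x * (\<Sum>i<n. H i (x i)))"
      by (simp add: mult.commute)
  qed
  also have "\<dots> \<le> ereal (\<Sum>i<n. U i)" by (auto intro!: sum_mono u)
  finally show ?thesis .
qed

section \<open>The spike and slab predictor\<close>

lemma ln_normal_density:
  assumes "0 < v"
  shows "ln (normal_density t (sqrt v) y) = - ln (2 * pi * v) / 2 - (y - t)\<^sup>2 / (2 * v)"
  using assms by (simp add: normal_density_def ln_mult ln_div ln_sqrt) (simp add: field_simps)

lemma ln_normal_density_shift:
  assumes "0 < v"
  shows "ln (normal_density t (sqrt v) y) - ln (normal_density 0 (sqrt v) y) = t\<^sup>2 / (2 * v) + t / v * (y - t)"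
  using assms by (simp add: ln_normal_density) (simp add: field_simps power2_eq_square)

lemma ln_one_plus_exp_le: "ln (1 + exp u) \<le> ln 2 + max 0 (u::real)"
proof -
  have "1 + exp u \<le> 2 * exp (max 0 u)" by (cases "0 \<le> u") auto
  then have "ln (1 + exp u) \<le> ln (2 * exp (max 0 u))"
    by (subst ln_le_cancel_iff) (auto simp: add_pos_pos)
  then show ?thesis by (simp add: ln_mult)
qed

lemma abs_le_half_one_plus_square: "\<bar>a\<bar> \<le> (1 + a\<^sup>2) / (2::real)"
  using zero_le_power2[of "\<bar>a\<bar> - 1"] by (simp add: power2_diff)

text \<open>
  The weights are logistic in \<open>l - x\<^sup>2 / 2\<close>, up to a constant the posterior log odds of a spike at 0 against
  a flat slab of height \<open>exp (- l)\<close>. The flat slab copes with arbitrarily large parameters.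
\<close>

definition spike_slab_predictor :: "real \<Rightarrow> real \<Rightarrow> real \<Rightarrow> real \<Rightarrow> real" where
  "spike_slab_predictor r l x y =
     normal_density 0 (sqrt r) y / (1 + exp (x\<^sup>2 / 2 - l))
     + normal_density x (sqrt (1 + r)) y / (1 + exp (l - x\<^sup>2 / 2))"

lemma spike_slab_predictor_measurable:
  "case_prod (spike_slab_predictor r l) \<in> borel_measurable (borel \<Otimes>\<^sub>M borel)"
  unfolding spike_slab_predictor_def normal_density_def by measurable

lemma spike_slab_predictor_pos:
  assumes "0 < r" shows "0 < spike_slab_predictor r l x y"
  using assms unfolding spike_slab_predictor_def
  by (intro add_pos_pos divide_pos_pos normal_density_pos) auto

lemma spike_slab_predictor_integral:
  assumes "0 < r"
  shows "has_bochner_integral lborel (spike_slab_predictor r l x) 1"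
proof -
  have "has_bochner_integral lborel (spike_slab_predictor r l x)
     (1 / (1 + exp (x\<^sup>2 / 2 - l)) + 1 / (1 + exp (l - x\<^sup>2 / 2)))"
    unfolding spike_slab_predictor_def
    using assms by (intro has_bochner_integral_add has_bochner_integral_divide_zero normal_density_integral) auto
  moreover have "1 / (1 + exp u) + 1 / (1 + exp (- u)) = 1" for u :: real
    by (simp add: exp_minus field_simps add_pos_pos[THEN less_imp_neq[THEN not_sym]])
  from this[of "x\<^sup>2 / 2 - l"] have "1 / (1 + exp (x\<^sup>2 / 2 - l)) + 1 / (1 + exp (l - x\<^sup>2 / 2)) = 1"
    by simp
  ultimately show ?thesis by simp
qed

lemma ln_div_le_of_part:
  fixes p q f w :: real
  assumes "0 < p" "0 < f" "0 < w" "f / w \<le> q"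
  shows "ln (p / q) \<le> ln w + ln p - ln f"
proof -
  have "0 < f / w" using assms by simp
  moreover from this assms(4) have "0 < q" by (rule less_le_trans)
  moreover have "ln (f / w) \<le> ln q"
    using assms \<open>0 < f / w\<close> by (intro ln_mono) auto
  ultimately show ?thesis using assms by (simp add: ln_div)
qed

lemma spike_bound:
  assumes r: "0 < r"
  shows "ln (normal_density t (sqrt r) y / spike_slab_predictor r l x y)
    \<le> ln (1 + exp (x\<^sup>2 / 2 - l)) + t\<^sup>2 / (2 * r) + t / r * (y - t)"
proof -
  have "ln (normal_density t (sqrt r) y / spike_slab_predictor r l x y)
    \<le> ln (1 + exp (x\<^sup>2 / 2 - l)) + ln (normal_density t (sqrt r) y) - ln (normal_density 0 (sqrt r) y)"
    by (rule ln_div_le_of_part)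
       (use r in \<open>auto intro!: normal_density_pos add_pos_pos divide_nonneg_pos simp: spike_slab_predictor_def\<close>)
  moreover note ln_normal_density_shift[OF r, of t y]
  ultimately show ?thesis by linarith
qed

lemma slab_bound:
  assumes r: "0 < r"
  shows "ln (normal_density t (sqrt r) y / spike_slab_predictor r l x y)
    \<le> ln (1 + exp (l - x\<^sup>2 / 2)) + ln (1 + 1 / r) / 2 + (x - t)\<^sup>2 / (2 * (1 + r))
      + - (x - t) / (1 + r) * (y - t) + (1 / (2 * (1 + r)) - 1 / (2 * r)) * (y - t)\<^sup>2"
proof -
  have "ln (normal_density t (sqrt r) y / spike_slab_predictor r l x y)
    \<le> ln (1 + exp (l - x\<^sup>2 / 2)) + ln (normal_density t (sqrt r) y)
        - ln (normal_density x (sqrt (1 + r)) y)"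
    by (rule ln_div_le_of_part)
       (use r in \<open>auto intro!: normal_density_pos add_pos_pos divide_nonneg_pos simp: spike_slab_predictor_def\<close>)
  moreover have "ln (normal_density t (sqrt r) y) - ln (normal_density x (sqrt (1 + r)) y)
      = ln (1 + 1 / r) / 2 + (y - x)\<^sup>2 / (2 * (1 + r)) - (y - t)\<^sup>2 / (2 * r)"
  proof -
    have "ln (1 + 1 / r) = ln (2 * pi * (1 + r)) - ln (2 * pi * r)"
    proof -
      have "1 + 1 / r = (2 * pi * (1 + r)) / (2 * pi * r)" using r by (simp add: field_simps)
      then show ?thesis using r by (simp only: ln_div) simp
    qed
    moreover have "0 < 1 + r" using r by simp
    ultimately show ?thesis using ln_normal_density[OF r] ln_normal_density[of "1 + r"] by simp
  qed
  moreover have "(y - x)\<^sup>2 / (2 * (1 + r)) - (y - t)\<^sup>2 / (2 * r) = (x - t)\<^sup>2 / (2 * (1 + r))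
      + - (x - t) / (1 + r) * (y - t) + (1 / (2 * (1 + r)) - 1 / (2 * r)) * (y - t)\<^sup>2"
    using r by (simp add: divide_simps) (simp add: algebra_simps power2_eq_square)
  ultimately show ?thesis by linarith
qed

lemma coord_risk_leI:
  assumes r: "0 < r"
    and h: "\<And>x y. ln (normal_density t (sqrt r) y / q x y) \<le> A x + B x * (y - t) + C * (y - t)\<^sup>2"
    and I: "has_bochner_integral lborel (\<lambda>x. normal_density t 1 x * (A x + C * r)) u" and u: "u \<le> U"
  shows "coord_risk_le r q t U"
  unfolding coord_risk_le_def
  by (intro exI[of _ "\<lambda>x y. A x + B x * (y - t) + C * (y - t)\<^sup>2"] exI[of _ "\<lambda>x. A x + C * r"]
      exI[of _ u] conjI allI h I u normal_density_moments r)

text \<open>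
  For exponents \<open>b < 1\<close>, \<open>(1 + v) \<le> (1 + v\<^sup>b)\<^bsup>1/b\<^esup>\<close>. With \<open>v = exp u\<close> and \<open>u = x\<^sup>2 / 2 - l\<close>, the right-hand side of the lemma stays
  integrable against the standard normal density, while the linear bound \<open>ln (1 + v) \<le> v\<close> does not.
\<close>

lemma ln_one_plus_exp_le_exp:
  fixes b u :: real
  assumes "1 / 2 \<le> b" "b < 1"
  shows "ln (1 + exp u) \<le> 2 * exp (b * u)"
proof -
  have "1 + exp u \<le> (1 + exp (b * u)) powr (1 / b)"
  proof (cases "u \<le> 0")
    case True
    have "exp u \<le> exp (b * u)" using True assms by (simp add: mult_le_cancel_right1)
    then have "1 + exp u \<le> (1 + exp (b * u)) powr 1" by (simp add: add_pos_pos)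
    also have "\<dots> \<le> (1 + exp (b * u)) powr (1 / b)"
      using assms by (intro powr_mono) auto
    finally show ?thesis .
  next
    case False
    have "1 + exp u = exp u * (1 + exp (- u))" by (simp add: algebra_simps exp_minus)
    also have "\<dots> \<le> exp u * (1 + exp (- (b * u)))"
      using False assms by (simp add: mult_le_cancel_right1)
    also have "\<dots> \<le> exp u * (1 + exp (- (b * u))) powr (1 / b)"
      using assms powr_mono[of 1 "1 / b" "1 + exp (- (b * u))"] by (simp add: add_pos_pos)
    also have "exp u * (1 + exp (- (b * u))) powr (1 / b) = exp (b * u) powr (1 / b) * (1 + exp (- (b * u))) powr (1 / b)"
      using assms by (simp add: powr_def)
    also have "\<dots> = (exp (b * u) * (1 + exp (- (b * u)))) powr (1 / b)"
      by (subst powr_mult) (auto simp: add_nonneg_nonneg)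
    also have "exp (b * u) * (1 + exp (- (b * u))) = 1 + exp (b * u)"
      by (simp add: algebra_simps exp_minus)
    finally show ?thesis .
  qed
  then have "ln (1 + exp u) \<le> ln ((1 + exp (b * u)) powr (1 / b))"
    by (intro ln_mono) (auto intro: add_pos_pos)
  also have "\<dots> = 1 / b * ln (1 + exp (b * u))" by (simp add: ln_powr)
  also have "\<dots> \<le> 2 * exp (b * u)"
    using assms by (intro mult_mono ln_add_one_self_le_self) (auto simp: field_simps)
  finally show ?thesis .
qed

lemma exp_square_normal_integral:
  assumes "0 < a"
  shows "has_bochner_integral lborel (\<lambda>x. normal_density 0 1 x * exp ((1 - a) * x\<^sup>2 / 2)) (1 / sqrt a)"
proof -
  have "has_bochner_integral lborel (\<lambda>x. normal_density 0 (sqrt (1 / a)) x * (1 / sqrt a)) (1 * (1 / sqrt a))"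
    using assms by (intro has_bochner_integral_mult_left normal_density_integral) auto
  moreover have "normal_density 0 (sqrt (1 / a)) x * (1 / sqrt a) = normal_density 0 1 x * exp ((1 - a) * x\<^sup>2 / 2)" for x
  proof -
    have "exp ((1 - a) * x\<^sup>2 / 2) * exp (- x\<^sup>2 / 2) = exp (- x\<^sup>2 * a / 2)"
      unfolding exp_add[symmetric] by (simp add: field_simps)
    then show ?thesis using assms by (simp add: normal_density_def real_sqrt_divide field_simps real_sqrt_mult)
  qed
  ultimately show ?thesis by simp
qed

text \<open>
  The exponent \<open>b = 1 - 1 / l\<close> costs a factor \<open>exp 1\<close> against the ideal \<open>exp (- l)\<close> and makes the
  Gaussian integral equal to \<open>sqrt l\<close>.
\<close>

lemma spike_slab_risk_zero:
  assumes r: "0 < r" and l: "2 \<le> l"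
  shows "coord_risk_le r (spike_slab_predictor r l) 0 (2 * exp 1 * exp (- l) * sqrt l)"
proof (rule coord_risk_leI[OF r, where B = "\<lambda>_. 0" and C = 0])
  let ?b = "1 - 1 / l"
  show "ln (normal_density 0 (sqrt r) y / spike_slab_predictor r l x y)
     \<le> 2 * exp (?b * (x\<^sup>2 / 2 - l)) + 0 * (y - 0) + 0 * (y - 0)\<^sup>2" for x y
    using spike_bound[OF r, of 0 y l x] ln_one_plus_exp_le_exp[of ?b "x\<^sup>2 / 2 - l"] l
    by (simp add: field_simps)
  have "?b * (x\<^sup>2 / 2 - l) = (1 + - l) + ((1 - 1 / l) * x\<^sup>2 / 2)" for x
    using l by (simp add: field_simps)
  then have "exp (?b * (x\<^sup>2 / 2 - l)) = exp 1 * exp (- l) * exp ((1 - 1 / l) * x\<^sup>2 / 2)" for x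
    by (simp only: exp_add)
  moreover have "has_bochner_integral lborel
      (\<lambda>x. 2 * exp 1 * exp (- l) * (normal_density 0 1 x * exp ((1 - 1 / l) * x\<^sup>2 / 2)))
      (2 * exp 1 * exp (- l) * (1 / sqrt (1 / l)))"
    using l by (intro has_bochner_integral_mult_right exp_square_normal_integral) auto
  ultimately show "has_bochner_integral lborel (\<lambda>x. normal_density 0 1 x *
      (2 * exp (?b * (x\<^sup>2 / 2 - l)) + 0 * r)) (2 * exp 1 * exp (- l) * sqrt l)"
    using l by (simp add: real_sqrt_divide mult_ac)
  show "2 * exp 1 * exp (- l) * sqrt l \<le> 2 * exp 1 * exp (- l) * sqrt l" ..
qed

text \<open>
  \<open>x \<mapsto> max 0 (l - x\<^sup>2 / 2)\<close> is Lipschitz with constant \<open>sqrt (2 l)\<close> and vanishes at \<open>t\<close>. The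
  bound \<open>|a| \<le> (1 + a\<^sup>2) / 2\<close> makes the result quadratic.
\<close>

lemma hinge_le_far:
  assumes "0 \<le> l" "2 * l < t\<^sup>2"
  shows "max 0 (l - x\<^sup>2 / 2) \<le> sqrt (2 * l) * ((1 + (x - t)\<^sup>2) / (2::real))"
proof -
  let ?m = "sqrt (2 * l)"
  have m: "0 \<le> ?m" "?m\<^sup>2 = 2 * l" using assms by auto
  have t: "?m < \<bar>t\<bar>" using assms(2) by (metis real_sqrt_abs real_sqrt_less_iff)
  have "max 0 (l - x\<^sup>2 / 2) \<le> ?m * \<bar>x - t\<bar>"
  proof (cases "?m \<le> \<bar>x\<bar>")
    case True
    then have "?m\<^sup>2 \<le> x\<^sup>2" using m by (metis abs_le_square_iff abs_of_nonneg)
    then show ?thesis using m by simp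
  next
    case False
    have "l - x\<^sup>2 / 2 = (?m - \<bar>x\<bar>) * ((?m + \<bar>x\<bar>) / 2)"
      using m by (simp add: power2_eq_square field_simps)
    also have "\<dots> \<le> (?m - \<bar>x\<bar>) * ?m"
      using False by (intro mult_left_mono) auto
    also have "\<dots> \<le> \<bar>x - t\<bar> * ?m"
      using t m by (intro mult_right_mono) auto
    finally show ?thesis using m by (simp add: mult.commute)
  qed
  also have "\<dots> \<le> ?m * ((1 + (x - t)\<^sup>2) / 2)"
    using m by (intro mult_left_mono abs_le_half_one_plus_square)
  finally show ?thesis .
qed

lemma hinge_le_near:
  assumes "0 \<le> l" "t\<^sup>2 \<le> 2 * l"
  shows "max 0 (l - x\<^sup>2 / 2) \<le> l - t\<^sup>2 / 2 + sqrt (2 * l) * ((1 + (x - t)\<^sup>2) / (2::real))"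
    and "max 0 (x\<^sup>2 / 2 - l) \<le> sqrt (2 * l) * ((1 + (x - t)\<^sup>2) / 2) + (x - t)\<^sup>2 / 2"
proof -
  let ?m = "sqrt (2 * l)"
  have "\<bar>t\<bar> \<le> ?m" using assms(2) by (metis real_sqrt_abs real_sqrt_le_iff)
  then have "\<bar>t * (x - t)\<bar> \<le> ?m * ((1 + (x - t)\<^sup>2) / 2)"
    unfolding abs_mult by (intro mult_mono abs_le_half_one_plus_square) (use assms in auto)
  moreover have "x\<^sup>2 / 2 = t\<^sup>2 / 2 + t * (x - t) + (x - t)\<^sup>2 / 2"
    by (simp add: power2_eq_square field_simps)
  moreover have "0 \<le> (x - t)\<^sup>2" "0 \<le> ?m * ((1 + (x - t)\<^sup>2) / 2)" using assms by auto
  ultimately show "max 0 (l - x\<^sup>2 / 2) \<le> l - t\<^sup>2 / 2 + ?m * ((1 + (x - t)\<^sup>2) / 2)"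
    "max 0 (x\<^sup>2 / 2 - l) \<le> ?m * ((1 + (x - t)\<^sup>2) / 2) + (x - t)\<^sup>2 / 2"
    using assms unfolding abs_le_iff by (intro max.boundedI; linarith)+
qed

text \<open>
  For \<open>t\<^sup>2 > 2 l\<close> the past observation identifies the slab and the slab bound alone suffices. For
  smaller \<open>t\<close> the spike bound \<open>t\<^sup>2 / (2 r)\<close> and the slab bound \<open>l - t\<^sup>2 / 2\<close> are averaged with the weights
  for which \<open>t\<close> cancels.
\<close>

lemma spike_slab_risk_le:
  assumes r: "0 < r" and l: "0 \<le> l"
  shows "coord_risk_le r (spike_slab_predictor r l) t (l / (1 + r) + sqrt (2 * l) + ln (1 + 1 / r) / 2 + 2)"
proof (cases "2 * l < t\<^sup>2")
  case far: True
  let ?m = "sqrt (2 * l)" and ?c = "ln (1 + 1 / r) / 2"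
  let ?A = "\<lambda>x. ln 2 + ?m * ((1 + (x - t)\<^sup>2) / 2) + ?c + (x - t)\<^sup>2 / (2 * (1 + r))"
  let ?C = "1 / (2 * (1 + r)) - 1 / (2 * r)"
  show ?thesis
  proof (rule coord_risk_leI[OF r, where A = ?A and B = "\<lambda>x. - (x - t) / (1 + r)" and C = ?C])
    show "ln (normal_density t (sqrt r) y / spike_slab_predictor r l x y)
      \<le> ?A x + - (x - t) / (1 + r) * (y - t) + ?C * (y - t)\<^sup>2" for x y
      using slab_bound[OF r, of t y l x] ln_one_plus_exp_le[of "l - x\<^sup>2 / 2"] hinge_le_far[OF l far, of x]
      by linarith
    have "?A x + ?C * r = (ln 2 + ?m / 2 + ?c + ?C * r) + 0 * (x - t) + (?m / 2 + 1 / (2 * (1 + r))) * (x - t)\<^sup>2" for x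
      by (simp add: algebra_simps add_divide_distrib)
    then show "has_bochner_integral lborel (\<lambda>x. normal_density t 1 x * (?A x + ?C * r))
      (ln 2 + ?m / 2 + ?c + ?C * r + (?m / 2 + 1 / (2 * (1 + r))) * 1)"
      using normal_density_moments[of 1 t] by (simp only: real_sqrt_one)
    have "?C * r + 1 / (2 * (1 + r)) = 0"
      using r by (simp add: divide_simps)
    moreover have "ln 2 \<le> (1::real)" using ln_le_minus_one[of "2::real"] by simp
    moreover have "0 \<le> l / (1 + r)" using r l by simp
    ultimately show "ln 2 + ?m / 2 + ?c + ?C * r + (?m / 2 + 1 / (2 * (1 + r))) * 1 \<le> l / (1 + r) + ?m + ?c + 2"
      by simp
  qed
next
  case False
  then have near: "t\<^sup>2 \<le> 2 * l" by simp
  \<comment> \<open>weight of the slab bound\<close>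
  define a where "a = 1 / (1 + r)"
  define m where "m = sqrt (2 * l)"
  define c where "c = ln (1 + 1 / r) / 2"
  have a: "0 < a" "0 < 1 - a" "a < 1" using r by (auto simp: a_def field_simps)
  have c: "0 \<le> c" using r by (simp add: c_def)
  define A1 where "A1 = (\<lambda>x. ln 2 + (l - t\<^sup>2 / 2 + m * ((1 + (x - t)\<^sup>2) / 2)) + c + (x - t)\<^sup>2 * (a / 2))"
  define A2 where "A2 = (\<lambda>x. ln 2 + (m * ((1 + (x - t)\<^sup>2) / 2) + (x - t)\<^sup>2 / 2) + t\<^sup>2 / (2 * r))"
  let ?C = "a / 2 - 1 / (2 * r)"
  let ?A = "\<lambda>x. a * A1 x + (1 - a) * A2 x" and ?B = "\<lambda>x. a * (- (x - t) * a) + (1 - a) * (t / r)"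
  show ?thesis
  proof (rule coord_risk_leI[OF r, where A = ?A and B = ?B and C = "a * ?C"])
    fix x y
    let ?q = "ln (normal_density t (sqrt r) y / spike_slab_predictor r l x y)"
    have "(x - t)\<^sup>2 / (2 * (1 + r)) = (x - t)\<^sup>2 * (a / 2)" "- (x - t) / (1 + r) = - (x - t) * a"
      "1 / (2 * (1 + r)) = a / 2"
      by (simp_all add: a_def)
    then have "?q \<le> ln (1 + exp (l - x\<^sup>2 / 2)) + c + (x - t)\<^sup>2 * (a / 2)
        + - (x - t) * a * (y - t) + ?C * (y - t)\<^sup>2"
      using slab_bound[OF r, of t y l x] unfolding c_def by (simp only:)
    then have 1: "?q \<le> A1 x + - (x - t) * a * (y - t) + ?C * (y - t)\<^sup>2"
      using ln_one_plus_exp_le[of "l - x\<^sup>2 / 2"] hinge_le_near(1)[OF l near, of x]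
      unfolding A1_def m_def by linarith
    have 2: "?q \<le> A2 x + t / r * (y - t)"
      using spike_bound[OF r, of t y l x] ln_one_plus_exp_le[of "x\<^sup>2 / 2 - l"] hinge_le_near(2)[OF l near, of x]
      unfolding A2_def m_def by linarith
    have "?q = a * ?q + (1 - a) * ?q" by (simp add: algebra_simps)
    also have "\<dots> \<le> a * (A1 x + - (x - t) * a * (y - t) + ?C * (y - t)\<^sup>2)
       + (1 - a) * (A2 x + t / r * (y - t))"
      using a by (intro add_mono mult_left_mono 1 2) auto
    also have "\<dots> = ?A x + ?B x * (y - t) + a * ?C * (y - t)\<^sup>2"
      by (simp only: distrib_left distrib_right add.assoc add.commute add.left_commute mult.assoc)
    finally show "?q \<le> ?A x + ?B x * (y - t) + a * ?C * (y - t)\<^sup>2" .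
  next
    let ?k0 = "a * (ln 2 + l - t\<^sup>2 / 2 + m / 2 + c) + (1 - a) * (ln 2 + m / 2 + t\<^sup>2 / (2 * r)) + a * ?C * r"
    let ?k2 = "a * (m / 2 + a / 2) + (1 - a) * (m / 2 + 1 / 2)"
    have "?A x + a * ?C * r = ?k0 + 0 * (x - t) + ?k2 * (x - t)\<^sup>2" for x
      unfolding A1_def A2_def by (simp add: algebra_simps add_divide_distrib)
    then show "has_bochner_integral lborel (\<lambda>x. normal_density t 1 x * (?A x + a * ?C * r)) (?k0 + ?k2 * 1)"
      using normal_density_moments[of 1 t] by (simp only: real_sqrt_one)
    have C: "?C * r = - a / 2" using r by (simp add: a_def divide_simps)
    \<comment> \<open>the cancellation of \<open>t\<close> that fixes the weights\<close>
    have t: "(1 - a) * (t\<^sup>2 / (2 * r)) = a * (t\<^sup>2 / 2)"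
    proof -
      have "1 - a = r * a" using r by (simp add: a_def divide_simps)
      then show ?thesis using r by simp
    qed
    have "?k0 + ?k2 * 1 = a * l + m + ln 2 + a * c + a * (?C * r) + a * (a / 2) + (1 - a) / 2
       + ((1 - a) * (t\<^sup>2 / (2 * r)) - a * (t\<^sup>2 / 2))"
      by (simp add: algebra_simps)
    also have "\<dots> = a * l + m + ln 2 + a * c + a * (- a / 2) + a * (a / 2) + (1 - a) / 2"
      unfolding C t by simp
    also have "\<dots> \<le> a * l + m + 1 + c + 1"
    proof -
      have "ln 2 \<le> (1::real)" using ln_le_minus_one[of "2::real"] by simp
      moreover have "a * c \<le> c" using a c by (simp add: mult_left_le_one_le)
      moreover have "a * (- a / 2) + a * (a / 2) + (1 - a) / 2 \<le> 1" using a by simp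
      ultimately show ?thesis by linarith
    qed
    finally show "?k0 + ?k2 * 1 \<le> l / (1 + r) + sqrt (2 * l) + ln (1 + 1 / r) / 2 + 2"
      by (simp add: a_def m_def c_def)
  qed
qed

lemma kl_risk_spike_slab_le:
  assumes r: "0 < r" and l: "2 \<le> l"
  shows "kl_risk n r \<theta> (product_predictor n (spike_slab_predictor r l))
    \<le> ereal (real n * (2 * exp 1 * exp (- l) * sqrt l)
        + real (card {i. i < n \<and> \<theta> i \<noteq> 0}) * (l / (1 + r) + sqrt (2 * l) + ln (1 + 1 / r) / 2 + 2))"
proof -
  let ?u0 = "2 * exp 1 * exp (- l) * sqrt l" and ?u1 = "l / (1 + r) + sqrt (2 * l) + ln (1 + 1 / r) / 2 + 2"
  have "kl_risk n r \<theta> (product_predictor n (spike_slab_predictor r l))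
      \<le> ereal (\<Sum>i<n. if \<theta> i \<noteq> 0 then ?u1 else ?u0)"
    using spike_slab_risk_zero[OF r l] spike_slab_risk_le[OF r, of l] l
    by (intro kl_risk_product_predictor_le r spike_slab_predictor_pos) auto
  also have "(\<Sum>i<n. if \<theta> i \<noteq> 0 then ?u1 else ?u0) \<le> (\<Sum>i<n. ?u0 + (if \<theta> i \<noteq> 0 then ?u1 else 0))"
    using l by (intro sum_mono) auto
  also have "\<dots> = real n * ?u0 + real (card {i. i < n \<and> \<theta> i \<noteq> 0}) * ?u1"
    by (simp add: sum.distrib sum.If_cases Int_def)
  finally show ?thesis by simp
qed

section \<open>The two-point prior as a discrete law on supports\<close>

definition spike_vector :: "nat \<Rightarrow> real \<Rightarrow> nat set \<Rightarrow> nat \<Rightarrow> real" where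
  "spike_vector n l S = (\<lambda>i\<in>{..<n}. if i \<in> S then l else 0)"

definition support_weight :: "nat \<Rightarrow> real \<Rightarrow> nat set \<Rightarrow> real" where
  "support_weight n \<eta> S = (\<Prod>i<n. if i \<in> S then \<eta> else 1 - \<eta>)"

lemma sum_prod_if_Pow:
  fixes f g :: "nat \<Rightarrow> 'a :: comm_semiring_1"
  shows "(\<Sum>S\<in>Pow {..<n}. \<Prod>i<n. if i \<in> S then f i else g i) = (\<Prod>i<n. f i + g i)"
proof -
  have "(\<Prod>i<n. if i \<in> S then f i else g i) = prod f S * prod g ({..<n} - S)"
    if "S \<in> Pow {..<n}" for S
    using that by (subst prod.If_cases) (auto simp: Int_absorb1 Diff_eq)
  then show ?thesis by (simp add: prod_add)
qed

lemma spike_vector_support: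
  assumes "l \<noteq> 0" "S \<subseteq> {..<n}"
  shows "{i. i < n \<and> spike_vector n l S i \<noteq> 0} = S"
  using assms by (auto simp: spike_vector_def)

lemma inj_on_spike_vector:
  assumes "l \<noteq> 0" shows "inj_on (spike_vector n l) (Pow {..<n})"
  by (rule inj_onI) (use spike_vector_support[OF assms] in \<open>metis PowD\<close>)

lemma PiE_two_points: "{..<n} \<rightarrow>\<^sub>E {0, l} \<subseteq> spike_vector n l ` Pow {..<n}"
proof
  fix x assume x: "x \<in> {..<n} \<rightarrow>\<^sub>E {0, l}"
  then have "x = spike_vector n l {i \<in> {..<n}. x i = l}"
    by (fastforce simp: spike_vector_def PiE_iff extensional_def)
  then show "x \<in> spike_vector n l ` Pow {..<n}" by auto
qed

lemma prob_space_two_point_law: "prob_space (two_point_law \<eta> l)"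
  unfolding two_point_law_def by (intro prob_space.prob_space_distr prob_space_measure_pmf) simp

lemma sets_two_point_law [simp]: "sets (two_point_law \<eta> l) = sets borel"
  by (simp add: two_point_law_def)

lemma iid_two_point_AE:
  assumes "0 \<le> \<eta>" "\<eta> \<le> 1"
  shows "AE x in Pi\<^sub>M {..<n} (\<lambda>_. two_point_law \<eta> l). x \<in> spike_vector n l ` Pow {..<n}"
proof -
  interpret product_prob_space "\<lambda>_::nat. two_point_law \<eta> l" "{..<n}"
    by (intro product_prob_spaceI prob_space_two_point_law)
  let ?P = "Pi\<^sub>M {..<n} (\<lambda>_. two_point_law \<eta> l)"
  have s: "{..<n} \<rightarrow>\<^sub>E {0, l} \<in> sets ?P"
    by (intro sets_PiM_I_finite) auto
  have "emeasure (two_point_law \<eta> l) {0, l} = 1"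
  proof -
    have "ennreal (1 - \<eta>) + ennreal \<eta> = ennreal (1 - \<eta> + \<eta>)"
      using assms by (intro ennreal_plus[symmetric]) auto
    then show ?thesis using assms by (simp add: emeasure_two_point_law)
  qed
  then have "emeasure ?P ({..<n} \<rightarrow>\<^sub>E {0, l}) = 1"
    by (subst emeasure_PiM) auto
  then have "AE x in ?P. x \<in> ({..<n} \<rightarrow>\<^sub>E {0, l})"
    by (intro P.AE_in_set_eq_1[THEN iffD2] s) (simp add: measure_def)
  then show ?thesis using PiE_two_points by (auto elim!: eventually_mono)
qed

lemma emeasure_iid_two_point:
  assumes "0 \<le> \<eta>" "\<eta> \<le> 1" "l \<noteq> 0"
  shows "{spike_vector n l S} \<in> sets (Pi\<^sub>M {..<n} (\<lambda>_. two_point_law \<eta> l))"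
    and "emeasure (Pi\<^sub>M {..<n} (\<lambda>_. two_point_law \<eta> l)) {spike_vector n l S} = ennreal (support_weight n \<eta> S)"
proof -
  interpret product_prob_space "\<lambda>_::nat. two_point_law \<eta> l" "{..<n}"
    by (intro product_prob_spaceI prob_space_two_point_law)
  have e: "{spike_vector n l S} = Pi\<^sub>E {..<n} (\<lambda>i. {spike_vector n l S i})"
    by (rule PiE_singleton[symmetric]) (simp add: spike_vector_def)
  show "{spike_vector n l S} \<in> sets (Pi\<^sub>M {..<n} (\<lambda>_. two_point_law \<eta> l))"
    by (subst e, intro sets_PiM_I_finite) auto
  have 1: "emeasure (two_point_law \<eta> l) {spike_vector n l S i} = ennreal (if i \<in> S then \<eta> else 1 - \<eta>)"
    if "i \<in> {..<n}" for i
    using assms that by (simp add: emeasure_two_point_law spike_vector_def)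
  have "emeasure (Pi\<^sub>M {..<n} (\<lambda>_. two_point_law \<eta> l)) {spike_vector n l S}
      = (\<Prod>i<n. emeasure (two_point_law \<eta> l) {spike_vector n l S i})"
    by (subst e, rule emeasure_PiM) auto
  also have "\<dots> = (\<Prod>i<n. ennreal (if i \<in> S then \<eta> else 1 - \<eta>))"
    by (rule prod.cong[OF refl 1])
  also have "\<dots> = ennreal (support_weight n \<eta> S)"
    unfolding support_weight_def using assms by (intro prod_ennreal) auto
  finally show "emeasure (Pi\<^sub>M {..<n} (\<lambda>_. two_point_law \<eta> l)) {spike_vector n l S} = ennreal (support_weight n \<eta> S)" .
qed

lemma iid_two_point_integral:
  assumes "0 \<le> \<eta>" "\<eta> \<le> 1" "l \<noteq> 0"
  shows "has_bochner_integral (Pi\<^sub>M {..<n} (\<lambda>_. two_point_law \<eta> l))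
     (\<lambda>\<theta>. \<Sum>S\<in>Pow {..<n}. indicator {spike_vector n l S} \<theta> * g S) (\<Sum>S\<in>Pow {..<n}. support_weight n \<eta> S * g S)"
proof (rule has_bochner_integral_sum, rule has_bochner_integral_mult_left)
  fix S
  have "0 \<le> support_weight n \<eta> S"
    using assms by (auto simp: support_weight_def intro!: prod_nonneg)
  then show "has_bochner_integral (Pi\<^sub>M {..<n} (\<lambda>_. two_point_law \<eta> l))
      (\<lambda>\<theta>. indicator {spike_vector n l S} \<theta> :: real) (support_weight n \<eta> S)"
    using has_bochner_integral_real_indicator[OF emeasure_iid_two_point(1)[OF assms, of n S]]
      emeasure_iid_two_point(2)[OF assms, of n S]
    by (simp add: measure_def)
qed

lemma sum_indicator_spike_vector:
  assumes "l \<noteq> 0" "T \<in> Pow {..<n}"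
  shows "(\<Sum>S\<in>Pow {..<n}. indicator {spike_vector n l S} (spike_vector n l T) * g S) = (g T :: real)"
proof -
  have "(\<Sum>S\<in>Pow {..<n}. indicator {spike_vector n l S} (spike_vector n l T) * g S)
      = (\<Sum>S\<in>Pow {..<n}. if S = T then g S else 0)"
    using inj_onD[OF inj_on_spike_vector[OF assms(1)]] assms(2)
    by (intro sum.cong) (auto simp: indicator_def)
  also have "\<dots> = g T" using assms(2) by simp
  finally show ?thesis .
qed

text \<open>
  The prior has finitely many atoms, so every integrand agrees almost everywhere with a finite sum of
  indicators. This takes the place of a measurability proof for the risk as a function of the parameter.
\<close>

lemma ext_integral_iid_two_point:
  fixes n :: nat
  assumes "0 \<le> \<eta>" "\<eta> \<le> 1" "l \<noteq> 0"
  defines "P \<equiv> Pi\<^sub>M {..<n} (\<lambda>_. two_point_law \<eta> l)"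
  shows "(\<And>S. S \<subseteq> {..<n} \<Longrightarrow> f (spike_vector n l S) \<le> ereal (g S)) \<Longrightarrow>
      ext_integral P f \<le> ereal (\<Sum>S\<in>Pow {..<n}. support_weight n \<eta> S * g S)"
    and "(\<And>S. S \<subseteq> {..<n} \<Longrightarrow> ereal (g S) \<le> f (spike_vector n l S)) \<Longrightarrow>
      ereal (\<Sum>S\<in>Pow {..<n}. support_weight n \<eta> S * g S) \<le> ext_integral P f"
  unfolding ext_integral_has_bochner_integral[OF iid_two_point_integral[OF assms(1-3)], symmetric] P_def
  using iid_two_point_AE[OF assms(1,2), of n l] sum_indicator_spike_vector[OF assms(3), of _ n g]
  by (auto intro!: ext_integral_mono_AE elim!: eventually_mono)

section \<open>Lower bounds by comparison with a reference density\<close>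

text \<open>
  The counterpart of \<^const>\<open>coord_risk_le\<close> for a reference density \<open>b\<close>.
\<close>

definition coord_risk_ge :: "real \<Rightarrow> (real \<Rightarrow> real \<Rightarrow> real) \<Rightarrow> real \<Rightarrow> real \<Rightarrow> bool" where
  "coord_risk_ge r b t K \<longleftrightarrow> (\<exists>h H.
     (\<forall>x y. h x y \<le> ln (normal_density t (sqrt r) y / b x y)) \<and>
     (\<forall>x. has_bochner_integral lborel (\<lambda>y. normal_density t (sqrt r) y * h x y) (H x)) \<and>
     has_bochner_integral lborel (\<lambda>x. normal_density t 1 x * H x) K)"

lemma ln_ge_one_minus: "0 < z \<Longrightarrow> 1 - 1 / z \<le> ln (z::real)"
  using ln_le_minus_one[of "1 / z"] by (simp add: ln_div)

lemma ln_div_ge_split: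
  fixes p b q s :: real
  assumes "0 < p" "0 < b" "0 < q" "s \<le> ln (p / b)"
  shows "s + 1 - q / b \<le> ln (p / q)"
  using assms ln_ge_one_minus[of "b / q"] by (simp add: ln_div)

text \<open>
  The inequality \<open>ln (p / q) \<ge> ln (p / b) + 1 - q / b\<close> replaces the arbitrary \<open>q\<close> by the product density \<open>b\<close>, up to
  the integral of \<open>F\<close>. For one fixed \<open>\<theta>\<close> that integral could be infinite; the
  domination by \<open>M\<close>, which holds when \<open>b\<close> comes from a mixture that charges \<open>\<theta>\<close>, makes it finite.
\<close>

lemma kl_risk_ge_comparator:
  assumes r: "0 < r" and b: "\<And>x y. 0 < b x y"
    and bm: "case_prod b \<in> borel_measurable (borel \<Otimes>\<^sub>M borel)"
    and q: "q \<in> pred_estimators n"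
    and K: "\<And>i. i < n \<Longrightarrow> coord_risk_ge r b (\<theta> i) (K i)"
    and M: "integrable (lborel_n n) M"
    and dom: "\<And>x y. gauss_density n 1 \<theta> x * gauss_density n r \<theta> y \<le> M x * product_predictor n b x y"
  defines "F \<equiv> \<lambda>x y. gauss_density n 1 \<theta> x * gauss_density n r \<theta> y / product_predictor n b x y * q x y"
  shows "\<And>x. x \<in> Rn n \<Longrightarrow> integrable (lborel_n n) (F x)"
    and "integrable (lborel_n n) (\<lambda>x. \<integral>y. F x y \<partial>lborel_n n)"
    and "ereal ((\<Sum>i<n. K i) + 1 - (\<integral>x. (\<integral>y. F x y \<partial>lborel_n n) \<partial>lborel_n n)) \<le> kl_risk n r \<theta> q"
proof -
  let ?B = "product_predictor n b"
  let ?p = "gauss_density n 1 \<theta>" and ?p' = "gauss_density n r \<theta>"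
  have p: "0 < ?p x" and p': "0 < ?p' x" for x
    using r by (auto intro: gauss_density_pos)
  have B: "0 < ?B x y" for x y using b by (simp add: product_predictor_def prod_pos)
  have qm: "case_prod q \<in> borel_measurable (lborel_n n \<Otimes>\<^sub>M lborel_n n)"
    and q0: "\<And>x y. x \<in> Rn n \<Longrightarrow> y \<in> Rn n \<Longrightarrow> 0 \<le> q x y"
    and q1: "\<And>x. x \<in> Rn n \<Longrightarrow> (\<integral>\<^sup>+ y. ennreal (q x y) \<partial>lborel_n n) = 1"
    using q by (auto simp: pred_estimators_def)
  note [measurable] = qm product_predictor_measurable[OF bm]
  have sp: "space (lborel_n n) = Rn n" by (simp add: space_PiM)
  have Fm: "case_prod F \<in> borel_measurable (lborel_n n \<Otimes>\<^sub>M lborel_n n)"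
    unfolding F_def by measurable
  have qi: "has_bochner_integral (lborel_n n) (q x) 1" if x: "x \<in> Rn n" for x
  proof (rule has_bochner_integral_nn_integral)
    show "q x \<in> borel_measurable (lborel_n n)"
      using measurable_compose[OF measurable_Pair1'[of x "lborel_n n" "lborel_n n"] qm] x sp by simp
  qed (use q0 q1 x sp in auto)
  have F0: "0 \<le> F x y" if "x \<in> Rn n" "y \<in> Rn n" for x y
    unfolding F_def using q0[OF that] p[of x] p'[of y] B[of x y] by simp
  have FM: "F x y \<le> M x * q x y" if "x \<in> Rn n" "y \<in> Rn n" for x y
  proof -
    have "?p x * ?p' y / ?B x y \<le> M x"
      using dom[of x y] B[of x y] by (simp add: divide_le_eq)
    then show ?thesis unfolding F_def by (intro mult_right_mono q0 that)
  qed
  show Fi: "integrable (lborel_n n) (F x)" if x: "x \<in> Rn n" for x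
  proof (rule Bochner_Integration.integrable_bound)
    show "integrable (lborel_n n) (\<lambda>y. M x * q x y)"
      using qi[OF x] by (simp add: has_bochner_integral_iff)
    show "F x \<in> borel_measurable (lborel_n n)"
      using measurable_compose[OF measurable_Pair1'[of x "lborel_n n" "lborel_n n"] Fm] x sp by simp
    show "AE y in lborel_n n. norm (F x y) \<le> norm (M x * q x y)"
      using F0[OF x] FM[OF x] sp by (intro AE_I2) (fastforce intro: order_trans[OF _ abs_ge_self])
  qed
  let ?J = "\<lambda>x. \<integral>y. F x y \<partial>lborel_n n"
  have Jm: "?J \<in> borel_measurable (lborel_n n)"
    by (rule sigma_finite_measure.borel_measurable_lebesgue_integral[OF sigma_finite_lborel_n Fm])
  have J0: "0 \<le> ?J x" if "x \<in> Rn n" for x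
    using F0[OF that] sp by (intro Bochner_Integration.integral_nonneg_AE AE_I2) auto
  have JM: "?J x \<le> M x" if x: "x \<in> Rn n" for x
  proof -
    have "?J x \<le> (\<integral>y. M x * q x y \<partial>lborel_n n)"
      using qi[OF x] FM[OF x] sp by (intro integral_mono Fi x) (auto simp: has_bochner_integral_iff)
    also have "\<dots> = M x" using qi[OF x] by (simp add: has_bochner_integral_iff)
    finally show ?thesis .
  qed
  show Ji: "integrable (lborel_n n) ?J"
    using J0 JM sp
    by (intro Bochner_Integration.integrable_bound[OF M Jm] AE_I2) (fastforce intro: order_trans[OF _ abs_ge_self])
  define ok where "ok i h H \<longleftrightarrow>
     (\<forall>x y. h x y \<le> ln (normal_density (\<theta> i) (sqrt r) y / b x y)) \<and>
     (\<forall>x. has_bochner_integral lborel (\<lambda>y. normal_density (\<theta> i) (sqrt r) y * h x y) (H x)) \<and>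
     has_bochner_integral lborel (\<lambda>x. normal_density (\<theta> i) 1 x * H x) (K i)" for i h H
  have "\<forall>i. \<exists>h H. i < n \<longrightarrow> ok i h H"
    using K unfolding coord_risk_ge_def ok_def by blast
  then obtain h H where ok: "\<And>i. i < n \<Longrightarrow> ok i (h i) (H i)" by metis
  have
    h: "\<And>i x y. i < n \<Longrightarrow> h i x y \<le> ln (normal_density (\<theta> i) (sqrt r) y / b x y)" and
    H: "\<And>i x. i < n \<Longrightarrow>
      has_bochner_integral lborel (\<lambda>y. normal_density (\<theta> i) (sqrt r) y * h i x y) (H i x)" and
    I: "\<And>i. i < n \<Longrightarrow> has_bochner_integral lborel (\<lambda>x. normal_density (\<theta> i) 1 x * H i x) (K i)"
    using ok unfolding ok_def by blast+
  have loss: "ereal ((\<Sum>i<n. H i (x i)) + 1 - ?J x / ?p x) \<le> kl_loss n r \<theta> (q x)" if x: "x \<in> Rn n" for x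
    unfolding kl_loss_def
  proof (rule le_ext_integral)
    show "has_bochner_integral (lborel_n n) (\<lambda>y. ?p' y * (\<Sum>i<n. h i (x i) (y i)) + ?p' y - F x y / ?p x)
      ((\<Sum>i<n. H i (x i)) + 1 - ?J x / ?p x)"
      using r H Fi[OF x]
      by (intro has_bochner_integral_diff has_bochner_integral_add gauss_density_integral_sum
          gauss_density_integral has_bochner_integral_divide_zero has_bochner_integral_integrable) auto
    fix y assume "y \<in> space (lborel_n n)"
    then have y: "y \<in> Rn n" using sp by simp
    show "ereal (?p' y * (\<Sum>i<n. h i (x i) (y i)) + ?p' y - F x y / ?p x)
      \<le> (if q x y = 0 then \<infinity> else ereal (?p' y * ln (?p' y / q x y)))"
    proof (cases "q x y = 0")
      case False
      then have "0 < q x y" using q0[OF x y] by simp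
      moreover have "(\<Sum>i<n. h i (x i) (y i)) \<le> ln (?p' y / ?B x y)"
        unfolding ln_gauss_density_div_product_predictor[of r b, OF r b]
        by (intro sum_mono h) simp
      ultimately have "(\<Sum>i<n. h i (x i) (y i)) + 1 - q x y / ?B x y \<le> ln (?p' y / q x y)"
        by (intro ln_div_ge_split p' B)
      then have "?p' y * ((\<Sum>i<n. h i (x i) (y i)) + 1 - q x y / ?B x y) \<le> ?p' y * ln (?p' y / q x y)"
        using p'[of y] by (intro mult_left_mono) auto
      moreover have "F x y / ?p x = ?p' y * (q x y / ?B x y)"
        using p[of x] by (simp add: F_def)
      ultimately show ?thesis using False by (simp add: algebra_simps)
    qed simp
  qed
  show "ereal ((\<Sum>i<n. K i) + 1 - (\<integral>x. ?J x \<partial>lborel_n n)) \<le> kl_risk n r \<theta> q"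
    unfolding kl_risk_def
  proof (rule le_ext_integral)
    show "has_bochner_integral (lborel_n n) (\<lambda>x. ?p x * (\<Sum>i<n. H i (x i)) + ?p x - ?J x)
      ((\<Sum>i<n. K i) + 1 - (\<integral>x. ?J x \<partial>lborel_n n))"
      using I Ji
      by (intro has_bochner_integral_diff has_bochner_integral_add gauss_density_integral_sum
          gauss_density_integral has_bochner_integral_integrable) auto
    fix x assume "x \<in> space (lborel_n n)"
    then have x: "x \<in> Rn n" using sp by simp
    have "ereal (?p x * (\<Sum>i<n. H i (x i)) + ?p x - ?J x)
        = ereal ((\<Sum>i<n. H i (x i)) + 1 - ?J x / ?p x) * ereal (?p x)"
      using p[of x] by (simp add: field_simps)
    also have "\<dots> \<le> kl_loss n r \<theta> (q x) * ereal (?p x)"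
      using p[of x] by (intro ereal_mult_right_mono loss x) simp
    finally show "ereal (?p x * (\<Sum>i<n. H i (x i)) + ?p x - ?J x) \<le> kl_loss n r \<theta> (q x) * ereal (?p x)" .
  qed
qed

section \<open>The Bayes predictive density of the two-point prior\<close>

definition mixture_past :: "real \<Rightarrow> real \<Rightarrow> real \<Rightarrow> real" where
  "mixture_past \<eta> l x = \<eta> * normal_density l 1 x + (1 - \<eta>) * normal_density 0 1 x"

definition mixture_joint :: "real \<Rightarrow> real \<Rightarrow> real \<Rightarrow> real \<Rightarrow> real \<Rightarrow> real" where
  "mixture_joint r \<eta> l x y = \<eta> * (normal_density l 1 x * normal_density l (sqrt r) y)
     + (1 - \<eta>) * (normal_density 0 1 x * normal_density 0 (sqrt r) y)"

definition bayes_predictor :: "real \<Rightarrow> real \<Rightarrow> real \<Rightarrow> real \<Rightarrow> real \<Rightarrow> real" where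
  "bayes_predictor r \<eta> l x y = mixture_joint r \<eta> l x y / mixture_past \<eta> l x"

lemma mixture_past_pos: "0 < \<eta> \<Longrightarrow> \<eta> < 1 \<Longrightarrow> 0 < mixture_past \<eta> l x"
  unfolding mixture_past_def by (intro add_pos_pos mult_pos_pos normal_density_pos) auto

lemma bayes_predictor_pos: "0 < r \<Longrightarrow> 0 < \<eta> \<Longrightarrow> \<eta> < 1 \<Longrightarrow> 0 < bayes_predictor r \<eta> l x y"
  unfolding bayes_predictor_def mixture_joint_def
  by (intro divide_pos_pos mixture_past_pos add_pos_pos mult_pos_pos normal_density_pos) auto

lemma bayes_predictor_measurable:
  "case_prod (bayes_predictor r \<eta> l) \<in> borel_measurable (borel \<Otimes>\<^sub>M borel)"
  unfolding bayes_predictor_def mixture_joint_def mixture_past_def by measurable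

lemma bayes_predictor_integral:
  assumes "0 < r" "0 < \<eta>" "\<eta> < 1"
  shows "has_bochner_integral lborel (bayes_predictor r \<eta> l x) 1"
proof -
  have "has_bochner_integral lborel (bayes_predictor r \<eta> l x)
    ((\<eta> * (normal_density l 1 x * 1) + (1 - \<eta>) * (normal_density 0 1 x * 1)) / mixture_past \<eta> l x)"
    unfolding bayes_predictor_def mixture_joint_def using assms
    by (intro has_bochner_integral_divide_zero has_bochner_integral_add has_bochner_integral_mult_right
        normal_density_integral)
  then show ?thesis
    using mixture_past_pos[OF assms(2,3), of l x] by (simp add: mixture_past_def)
qed

lemma bayes_predictor_risk_zero_ge:
  assumes r: "0 < r" and \<eta>: "0 < \<eta>" "\<eta> < 1"
  shows "coord_risk_ge r (bayes_predictor r \<eta> l) 0 0"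
  unfolding coord_risk_ge_def
proof (intro exI conjI allI)
  let ?b = "bayes_predictor r \<eta> l" and ?p = "normal_density 0 (sqrt r)"
  have p: "0 < ?p y" for y using r by (simp add: normal_density_pos)
  show "1 - ?b x y / ?p y \<le> ln (?p y / ?b x y)" for x y
    using ln_ge_one_minus[of "?p y / ?b x y"] p[of y] bayes_predictor_pos[OF r \<eta>, of l x y] by simp
  have "has_bochner_integral lborel (\<lambda>y. ?p y - ?b x y) (1 - 1)" for x
    using r by (intro has_bochner_integral_diff normal_density_integral bayes_predictor_integral \<eta>)
  moreover have "?p y * (1 - ?b x y / ?p y) = ?p y - ?b x y" for x y
    using p[of y] by (simp add: field_simps)
  ultimately show "has_bochner_integral lborel (\<lambda>y. ?p y * (1 - ?b x y / ?p y)) ((\<lambda>_. 0) x)" for x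
    by simp
qed (simp add: has_bochner_integral_zero)

text \<open>
  The main term \<open>l\<^sup>2 / (2 r)\<close> is the divergence of \<open>N(l, r)\<close> from \<open>N(0, r)\<close>; the rest bounds
  what the Bayes predictor can recover when the evidence for a spike is only balanced.
\<close>

definition spike_gain :: "real \<Rightarrow> real \<Rightarrow> real" where
  "spike_gain r l = l\<^sup>2 / (2 * r) - ln 2 - l - l / sqrt r"

text \<open>
  With \<open>U\<close> the posterior log odds of a spike given both observations, the predictive density is at
  most \<open>N(0, r)\<close> times \<open>1 + exp U\<close>. The balance condition removes the constant term of \<open>U\<close>, which is
  then linear in the centred noise and has size \<open>O(l)\<close>, small against the log ratio of \<open>N(l, r)\<close> to
  \<open>N(0, r)\<close> with mean \<open>l\<^sup>2 / (2 r)\<close>.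
\<close>

lemma bayes_predictor_risk_spike_ge:
  assumes r: "0 < r" and \<eta>: "0 < \<eta>" "\<eta> < 1" and l: "0 \<le> l"
    and bal: "l\<^sup>2 / 2 * (1 + 1 / r) = ln ((1 - \<eta>) / \<eta>)"
  shows "coord_risk_ge r (bayes_predictor r \<eta> l) l (spike_gain r l)"
  unfolding coord_risk_ge_def
proof (intro exI conjI allI)
  let ?b = "bayes_predictor r \<eta> l"
  let ?h0 = "\<lambda>x. l\<^sup>2 / (2 * r) - ln 2 - l * ((1 + (x - l)\<^sup>2) / 2) - l / sqrt r / 2"
  let ?h = "\<lambda>x y. ?h0 x + l / r * (y - l) + - (l / (2 * r * sqrt r)) * (y - l)\<^sup>2"
  fix x y
  let ?U = "l * (x - l) + l / r * (y - l)"
  let ?a = "normal_density 0 1 x" and ?c = "normal_density 0 (sqrt r) y"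
  let ?a' = "normal_density l 1 x" and ?c' = "normal_density l (sqrt r) y"
  have pos: "0 < ?a" "0 < ?c" "0 < ?a'" "0 < ?c'" using r by (auto intro: normal_density_pos)
  have c: "ln ?c' - ln ?c = l\<^sup>2 / (2 * r) + l / r * (y - l)"
    by (rule ln_normal_density_shift[OF r])
  have a: "ln ?a' - ln ?a = l\<^sup>2 / 2 + l * (x - l)"
    using ln_normal_density_shift[of 1 l x] by simp
  have "?U = ln \<eta> - ln (1 - \<eta>) + (ln ?a' - ln ?a) + (ln ?c' - ln ?c)"
  proof -
    have "l\<^sup>2 / 2 + l\<^sup>2 / (2 * r) = ln (1 - \<eta>) - ln \<eta>"
      using bal \<eta> by (simp add: ln_div distrib_left)
    then show ?thesis unfolding a c by linarith
  qed
  also have "\<dots> = ln ((\<eta> * (?a' * ?c')) / ((1 - \<eta>) * (?a * ?c)))"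
    using pos \<eta> by (simp add: ln_div ln_mult)
  finally have "exp ?U = (\<eta> * (?a' * ?c')) / ((1 - \<eta>) * (?a * ?c))"
    using pos \<eta> by (simp only: exp_ln divide_pos_pos mult_pos_pos diff_gt_0_iff_gt)
  then have joint: "mixture_joint r \<eta> l x y = (1 - \<eta>) * (?a * ?c) * (1 + exp ?U)"
    using pos \<eta> by (simp add: mixture_joint_def field_simps)
  have "?b x y \<le> mixture_joint r \<eta> l x y / ((1 - \<eta>) * ?a)"
    unfolding bayes_predictor_def
  proof (rule divide_left_mono)
    show "(1 - \<eta>) * ?a \<le> mixture_past \<eta> l x" using pos \<eta> by (simp add: mixture_past_def)
    show "0 \<le> mixture_joint r \<eta> l x y" using pos \<eta> by (simp add: mixture_joint_def)
    show "0 < mixture_past \<eta> l x * ((1 - \<eta>) * ?a)" using pos \<eta> mixture_past_pos[OF \<eta>] by simp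
  qed
  also have "\<dots> = ?c * (1 + exp ?U)" unfolding joint using pos \<eta> by simp
  finally have "ln (?b x y) \<le> ln (?c * (1 + exp ?U))"
    by (intro ln_mono bayes_predictor_pos r \<eta>)
  also have "\<dots> = ln ?c + ln (1 + exp ?U)"
    using pos by (simp add: ln_mult add_pos_pos[THEN less_imp_neq[THEN not_sym]])
  finally have "ln ?c' - ln ?c - ln (1 + exp ?U) \<le> ln (?c' / ?b x y)"
    using pos bayes_predictor_pos[OF r \<eta>, of l x y] by (simp add: ln_div)
  moreover have "ln (1 + exp ?U) \<le> ln 2 + l * ((1 + (x - l)\<^sup>2) / 2) + (l / sqrt r / 2 + l / (2 * r * sqrt r) * (y - l)\<^sup>2)"
  proof -
    have "l * (x - l) \<le> l * ((1 + (x - l)\<^sup>2) / 2)"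
      by (intro mult_left_mono order_trans[OF abs_ge_self abs_le_half_one_plus_square] l)
    moreover have "l / r * (y - l) \<le> l / sqrt r / 2 + l / (2 * r * sqrt r) * (y - l)\<^sup>2"
    proof -
      have s: "0 < sqrt r" "r = sqrt r * sqrt r" using r by auto
      have "(y - l) / sqrt r \<le> (1 + ((y - l) / sqrt r)\<^sup>2) / 2"
        using abs_le_half_one_plus_square[of "(y - l) / sqrt r"] by linarith
      then have "l / sqrt r * ((y - l) / sqrt r) \<le> l / sqrt r * ((1 + ((y - l) / sqrt r)\<^sup>2) / 2)"
        using l r by (intro mult_left_mono) auto
      also have "l / sqrt r * ((y - l) / sqrt r) = l / r * (y - l)"
        using s by (metis times_divide_times_eq times_divide_eq_left)
      also have "l / sqrt r * ((1 + ((y - l) / sqrt r)\<^sup>2) / 2) = l / sqrt r / 2 + l / (2 * r * sqrt r) * (y - l)\<^sup>2"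
        using r by (simp add: power_divide field_simps)
      finally show ?thesis .
    qed
    moreover have "0 \<le> l * ((1 + (x - l)\<^sup>2) / 2)" "0 \<le> l / sqrt r / 2 + l / (2 * r * sqrt r) * (y - l)\<^sup>2"
      using l r by auto
    ultimately show ?thesis using ln_one_plus_exp_le[of ?U] by linarith
  qed
  ultimately show "?h x y \<le> ln (?c' / ?b x y)" unfolding c by linarith
next
  fix x
  let ?h0 = "\<lambda>x. l\<^sup>2 / (2 * r) - ln 2 - l * ((1 + (x - l)\<^sup>2) / 2) - l / sqrt r / 2"
  show "has_bochner_integral lborel (\<lambda>y. normal_density l (sqrt r) y *
     (?h0 x + l / r * (y - l) + - (l / (2 * r * sqrt r)) * (y - l)\<^sup>2))
     ((\<lambda>x. ?h0 x + - (l / (2 * r * sqrt r)) * r) x)"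
    by (rule normal_density_moments[OF r])
next
  let ?h0 = "\<lambda>x. l\<^sup>2 / (2 * r) - ln 2 - l * ((1 + (x - l)\<^sup>2) / 2) - l / sqrt r / 2"
  have e: "?h0 x + - (l / (2 * r * sqrt r)) * r = (l\<^sup>2 / (2 * r) - ln 2 - l / 2 - l / sqrt r) + 0 * (x - l) + (- l / 2) * (x - l)\<^sup>2" for x
    using r by (simp add: field_simps)
  have "spike_gain r l = (l\<^sup>2 / (2 * r) - ln 2 - l / 2 - l / sqrt r) + (- l / 2) * 1"
    by (simp add: spike_gain_def)
  then show "has_bochner_integral lborel (\<lambda>x. normal_density l 1 x *
      (?h0 x + - (l / (2 * r * sqrt r)) * r)) (spike_gain r l)"
    unfolding e using normal_density_moments[of 1 l] by (simp only: real_sqrt_one)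
qed

lemma support_weight_pos: "0 < \<eta> \<Longrightarrow> \<eta> < 1 \<Longrightarrow> 0 < support_weight n \<eta> S"
  unfolding support_weight_def by (intro prod_pos) auto

lemma sum_support_weight: "(\<Sum>S\<in>Pow {..<n}. support_weight n \<eta> S) = 1"
  unfolding support_weight_def sum_prod_if_Pow by simp

lemma mixture_joint_prod:
  "(\<Sum>S\<in>Pow {..<n}. support_weight n \<eta> S *
      (gauss_density n 1 (spike_vector n l S) x * gauss_density n r (spike_vector n l S) y))
   = (\<Prod>i<n. mixture_joint r \<eta> l (x i) (y i))"
proof -
  have "support_weight n \<eta> S *
      (gauss_density n 1 (spike_vector n l S) x * gauss_density n r (spike_vector n l S) y)
    = (\<Prod>i<n. if i \<in> S then \<eta> * (normal_density l 1 (x i) * normal_density l (sqrt r) (y i))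
        else (1 - \<eta>) * (normal_density 0 1 (x i) * normal_density 0 (sqrt r) (y i)))" for S
    unfolding support_weight_def gauss_density_def prod.distrib[symmetric]
    by (rule prod.cong) (auto simp: spike_vector_def)
  then show ?thesis by (simp add: sum_prod_if_Pow mixture_joint_def)
qed

lemma mixture_past_integral: "has_bochner_integral lborel (mixture_past \<eta> l) 1"
proof -
  have "has_bochner_integral lborel (mixture_past \<eta> l) (\<eta> * 1 + (1 - \<eta>) * 1)"
    unfolding mixture_past_def
    using normal_density_integral[of 1]
    by (intro has_bochner_integral_add has_bochner_integral_mult_right) auto
  then show ?thesis by simp
qed

text \<open>
  \<open>T S\<close> is the expectation of \<open>q / b\<close> at the spike vector with support \<open>S\<close>. Averaged over the prior it is the
  integral of \<open>m(x) q(x, y)\<close>, where \<open>m\<close> is the marginal density of the past observation, hence one.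
\<close>

lemma kl_risk_spike_vector_ge:
  assumes r: "0 < r" and \<eta>: "0 < \<eta>" "\<eta> < 1" and l: "0 < l"
    and bal: "l\<^sup>2 / 2 * (1 + 1 / r) = ln ((1 - \<eta>) / \<eta>)"
    and q: "q \<in> pred_estimators n"
  shows "\<exists>T. (\<forall>S\<subseteq>{..<n}. 0 \<le> T S \<and>
      ereal (spike_gain r l * real (card S) + 1 - T S) \<le> kl_risk n r (spike_vector n l S) q) \<and>
      (\<Sum>S\<in>Pow {..<n}. support_weight n \<eta> S * T S) = 1"
proof -
  let ?b = "bayes_predictor r \<eta> l" and ?w = "support_weight n \<eta>" and ?\<theta> = "spike_vector n l"
  let ?B = "product_predictor n ?b"
  define m where "m = (\<lambda>x::nat \<Rightarrow> real. \<Prod>i<n. mixture_past \<eta> l (x i))"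
  define F where "F = (\<lambda>S x y. gauss_density n 1 (?\<theta> S) x * gauss_density n r (?\<theta> S) y / ?B x y * q x y)"
  define T where "T = (\<lambda>S. \<integral>x. (\<integral>y. F S x y \<partial>lborel_n n) \<partial>lborel_n n)"
  have b: "0 < ?b x y" for x y by (rule bayes_predictor_pos[OF r \<eta>])
  have B: "0 < ?B x y" for x y using b by (simp add: product_predictor_def prod_pos)
  have m: "0 < m x" for x unfolding m_def by (intro prod_pos mixture_past_pos \<eta> ballI)
  have mi: "has_bochner_integral (lborel_n n) m 1"
    unfolding m_def using has_bochner_integral_prod[of n "\<lambda>_. mixture_past \<eta> l" "\<lambda>_. 1"]
      mixture_past_integral by simp
  have mB: "(\<Sum>S\<in>Pow {..<n}. ?w S * (gauss_density n 1 (?\<theta> S) x * gauss_density n r (?\<theta> S) y))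
      = m x * ?B x y" for x y
    using mixture_past_pos[OF \<eta>, of l]
    by (simp add: mixture_joint_prod m_def product_predictor_def bayes_predictor_def
        prod.distrib[symmetric] less_imp_neq[THEN not_sym])
  have w: "0 < ?w S" for S by (rule support_weight_pos[OF \<eta>])
  have g: "0 \<le> gauss_density n 1 \<theta> x * gauss_density n r \<theta> y" for \<theta> x y
    using r by (intro mult_nonneg_nonneg less_imp_le gauss_density_pos) auto
  \<comment> \<open>a single term of the mixture is at most the whole mixture\<close>
  have dom: "gauss_density n 1 (?\<theta> S) x * gauss_density n r (?\<theta> S) y \<le> m x / ?w S * ?B x y"
    if S: "S \<in> Pow {..<n}" for S x y
  proof -
    have "?w S * (gauss_density n 1 (?\<theta> S) x * gauss_density n r (?\<theta> S) y) \<le> m x * ?B x y"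
      unfolding mB[symmetric]
      by (intro member_le_sum S mult_nonneg_nonneg g less_imp_le[OF w]) auto
    then show ?thesis using w[of S] by (simp add: field_simps)
  qed
  define K where "K = (\<lambda>(S :: nat set) i. if i \<in> S then spike_gain r l else 0)"
  have K: "coord_risk_ge r ?b (?\<theta> S i) (K S i)" if "i < n" for S i
    using that bayes_predictor_risk_zero_ge[OF r \<eta>] bayes_predictor_risk_spike_ge[OF r \<eta> less_imp_le[OF l] bal]
    by (simp add: K_def spike_vector_def)
  have Mi: "integrable (lborel_n n) (\<lambda>x. m x / ?w S)" for S
    using mi by (simp add: has_bochner_integral_iff)
  have Fi: "integrable (lborel_n n) (F S x)" if "S \<in> Pow {..<n}" "x \<in> Rn n" for S x
    unfolding F_def by (rule kl_risk_ge_comparator(1)[OF r b bayes_predictor_measurable q K Mi dom[OF that(1)] that(2)])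
  have Ji: "integrable (lborel_n n) (\<lambda>x. \<integral>y. F S x y \<partial>lborel_n n)" if "S \<in> Pow {..<n}" for S
    unfolding F_def by (rule kl_risk_ge_comparator(2)[OF r b bayes_predictor_measurable q K Mi dom[OF that]])
  have le: "ereal ((\<Sum>i<n. K S i) + 1 - T S) \<le> kl_risk n r (?\<theta> S) q" if "S \<in> Pow {..<n}" for S
    unfolding F_def T_def by (rule kl_risk_ge_comparator(3)[OF r b bayes_predictor_measurable q K Mi dom[OF that]])
  have sp: "space (lborel_n n) = Rn n" by (simp add: space_PiM)
  have q0: "\<And>x y. x \<in> Rn n \<Longrightarrow> y \<in> Rn n \<Longrightarrow> 0 \<le> q x y"
    and q1: "\<And>x. x \<in> Rn n \<Longrightarrow> (\<integral>\<^sup>+ y. ennreal (q x y) \<partial>lborel_n n) = 1"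
    and qm: "case_prod q \<in> borel_measurable (lborel_n n \<Otimes>\<^sub>M lborel_n n)"
    using q by (auto simp: pred_estimators_def)
  have qi: "integral\<^sup>L (lborel_n n) (q x) = 1" if x: "x \<in> Rn n" for x
    using q0[OF x] q1[OF x] sp by (subst integral_eq_nn_integral)
      (use measurable_compose[OF measurable_Pair1'[of x "lborel_n n" "lborel_n n"] qm] x sp in auto)
  have "(\<Sum>S\<in>Pow {..<n}. ?w S * T S)
      = (\<integral>x. (\<Sum>S\<in>Pow {..<n}. ?w S * (\<integral>y. F S x y \<partial>lborel_n n)) \<partial>lborel_n n)"
    unfolding T_def using Ji by (subst Bochner_Integration.integral_sum) auto
  also have "\<dots> = (\<integral>x. m x \<partial>lborel_n n)"
  proof (rule Bochner_Integration.integral_cong[OF refl])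
    fix x assume "x \<in> space (lborel_n n)"
    then have x: "x \<in> Rn n" using sp by simp
    have "(\<Sum>S\<in>Pow {..<n}. ?w S * (\<integral>y. F S x y \<partial>lborel_n n))
        = (\<integral>y. (\<Sum>S\<in>Pow {..<n}. ?w S * F S x y) \<partial>lborel_n n)"
      using Fi[OF _ x] by (subst Bochner_Integration.integral_sum) auto
    also have "(\<lambda>y. \<Sum>S\<in>Pow {..<n}. ?w S * F S x y) = (\<lambda>y. m x * q x y)"
    proof
      fix y
      have "(\<Sum>S\<in>Pow {..<n}. ?w S * F S x y)
        = (\<Sum>S\<in>Pow {..<n}. ?w S * (gauss_density n 1 (?\<theta> S) x * gauss_density n r (?\<theta> S) y)) / ?B x y * q x y"
        by (simp add: F_def sum_divide_distrib sum_distrib_right mult.assoc)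
      then show "(\<Sum>S\<in>Pow {..<n}. ?w S * F S x y) = m x * q x y"
        using B[of x y] by (simp add: mB)
    qed
    finally show "(\<Sum>S\<in>Pow {..<n}. ?w S * (\<integral>y. F S x y \<partial>lborel_n n)) = m x"
      using qi[OF x] by simp
  qed
  finally have sumT: "(\<Sum>S\<in>Pow {..<n}. ?w S * T S) = 1"
    using mi by (simp add: has_bochner_integral_iff)
  have "0 \<le> T S" for S
    unfolding T_def using sp
    by (intro Bochner_Integration.integral_nonneg_AE AE_I2)
       (auto simp: F_def intro!: mult_nonneg_nonneg divide_nonneg_pos g B q0)
  moreover have "ereal (spike_gain r l * real (card S) + 1 - T S) \<le> kl_risk n r (?\<theta> S) q"
    if S: "S \<subseteq> {..<n}" for S
  proof -
    have "(\<Sum>i<n. K S i) = spike_gain r l * real (card S)"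
      using S by (simp add: K_def sum.If_cases Int_absorb1)
    then show ?thesis using le[of S] S by simp
  qed
  ultimately show ?thesis using sumT by blast
qed

section \<open>Size of the random support\<close>

lemma support_weight_eq:
  assumes "S \<subseteq> {..<n}"
  shows "support_weight n \<eta> S = \<eta> ^ card S * (1 - \<eta>) ^ (n - card S)"
proof -
  have "card ({..<n} - S) = n - card S"
    using assms by (simp add: card_Diff_subset finite_subset)
  then show ?thesis
    using assms unfolding support_weight_def
    by (subst prod.If_cases) (auto simp: Int_absorb1 Diff_eq[symmetric])
qed

text \<open>
  The size of the support is binomial, so its moments are those of the Bernstein polynomials.
\<close>

lemma sum_support_weight_card:
  "(\<Sum>S\<in>Pow {..<n}. support_weight n \<eta> S * f (card S)) = (\<Sum>k\<le>n. f k * Bernstein n k \<eta>)"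
proof -
  have c: "card ` Pow {..<n} \<subseteq> {..n}"
    using card_mono[of "{..<n}"] by fastforce
  have "(\<Sum>S\<in>Pow {..<n}. support_weight n \<eta> S * f (card S))
    = (\<Sum>k\<le>n. \<Sum>S\<in>{S\<in>Pow {..<n}. card S = k}. support_weight n \<eta> S * f (card S))"
    by (rule sum.group[symmetric]) (use c in auto)
  also have "\<dots> = (\<Sum>k\<le>n. f k * Bernstein n k \<eta>)"
  proof (rule sum.cong[OF refl])
    fix k
    have "(\<Sum>S\<in>{S\<in>Pow {..<n}. card S = k}. support_weight n \<eta> S * f (card S))
      = (\<Sum>S\<in>{S\<in>Pow {..<n}. card S = k}. \<eta> ^ k * (1 - \<eta>) ^ (n - k) * f k)"
      by (rule sum.cong) (auto simp: support_weight_eq)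
    also have "\<dots> = real (card {S\<in>Pow {..<n}. card S = k}) * (\<eta> ^ k * (1 - \<eta>) ^ (n - k) * f k)"
      by simp
    also have "card {S\<in>Pow {..<n}. card S = k} = n choose k"
      using n_subsets[of "{..<n}" k] by simp
    finally show "(\<Sum>S\<in>{S\<in>Pow {..<n}. card S = k}. support_weight n \<eta> S * f (card S)) = f k * Bernstein n k \<eta>"
      by (simp add: Bernstein_def)
  qed
  finally show ?thesis .
qed

lemma sum_support_weight_card_id:
  "(\<Sum>S\<in>Pow {..<n}. support_weight n \<eta> S * real (card S)) = real n * \<eta>"
  using sum_support_weight_card[of n \<eta> real] by simp

text \<open>
  Chebyshev's inequality in the form \<open>k \<le> s (k - \<mu>)\<^sup>2 / (s - \<mu>)\<^sup>2\<close> for \<open>k > s > \<mu>\<close>, which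
  bounds the expected number of spikes on the event that there are more than \<open>s\<close>.
\<close>

lemma truncated_mean_ge:
  assumes \<eta>: "0 < \<eta>" "\<eta> < 1" and s: "real n * \<eta> < real s"
  defines "\<mu> \<equiv> real n * \<eta>"
  shows "\<mu> - \<mu> * real s / (real s - \<mu>)\<^sup>2
    \<le> (\<Sum>S | S \<subseteq> {..<n} \<and> card S \<le> s. support_weight n \<eta> S * real (card S))"
proof -
  let ?c = "real s / (real s - \<mu>)\<^sup>2"
  have \<mu>: "0 \<le> \<mu>" "\<mu> < real s" using \<eta> s by (auto simp: \<mu>_def)
  have pw: "real k - ?c * (real k - \<mu>)\<^sup>2 \<le> (if k \<le> s then real k else 0)" for k
  proof (cases "k \<le> s")
    case True then show ?thesis using \<mu> by simp
  next
    case False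
    then have k: "real s < real k" by simp
    have "real s * (real k - \<mu>)\<^sup>2 - real k * (real s - \<mu>)\<^sup>2 = (real k - real s) * (real s * real k - \<mu> * \<mu>)"
      by (simp add: power2_eq_square algebra_simps)
    also have "\<dots> \<ge> 0"
      using k \<mu> by (intro mult_nonneg_nonneg) (auto intro!: mult_mono)
    finally have "real k \<le> ?c * (real k - \<mu>)\<^sup>2"
      using \<mu> by (simp add: field_simps)
    then show ?thesis using False by simp
  qed
  have var: "(\<Sum>k\<le>n. (real k - \<mu>)\<^sup>2 * Bernstein n k \<eta>) \<le> \<mu>"
  proof -
    have "(real k - \<mu>)\<^sup>2 * Bernstein n k \<eta> = real k * (real k - 1) * Bernstein n k \<eta>
        + (1 - 2 * \<mu>) * (real k * Bernstein n k \<eta>) + \<mu>\<^sup>2 * Bernstein n k \<eta>" for k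
      by (simp add: power2_eq_square algebra_simps)
    then have "(\<Sum>k\<le>n. (real k - \<mu>)\<^sup>2 * Bernstein n k \<eta>) = real n * (real n - 1) * \<eta>\<^sup>2 + (1 - 2 * \<mu>) * \<mu> + \<mu>\<^sup>2"
      by (simp add: sum.distrib sum_distrib_left[symmetric] \<mu>_def)
    also have "\<dots> = \<mu> - real n * \<eta>\<^sup>2" by (simp add: \<mu>_def power2_eq_square algebra_simps)
    also have "\<dots> \<le> \<mu>" by simp
    finally show ?thesis .
  qed
  have "\<mu> - \<mu> * real s / (real s - \<mu>)\<^sup>2 = \<mu> - ?c * \<mu>" by simp
  also have "\<dots> \<le> \<mu> - ?c * (\<Sum>k\<le>n. (real k - \<mu>)\<^sup>2 * Bernstein n k \<eta>)"
    using var by (intro diff_left_mono mult_left_mono) auto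
  also have "\<dots> = (\<Sum>k\<le>n. (real k - ?c * (real k - \<mu>)\<^sup>2) * Bernstein n k \<eta>)"
    by (simp add: left_diff_distrib sum_subtractf sum_distrib_left mult.assoc \<mu>_def)
  also have "\<dots> \<le> (\<Sum>k\<le>n. (if k \<le> s then real k else 0) * Bernstein n k \<eta>)"
    using \<eta> by (intro sum_mono mult_right_mono pw Bernstein_nonneg) auto
  also have "\<dots> = (\<Sum>S\<in>Pow {..<n}. support_weight n \<eta> S * (if card S \<le> s then real (card S) else 0))"
    by (rule sum_support_weight_card[symmetric])
  also have "\<dots> = (\<Sum>S | S \<subseteq> {..<n} \<and> card S \<le> s. support_weight n \<eta> S * real (card S))"
    by (rule sum.mono_neutral_cong_right) auto
  finally show ?thesis .
qed

section \<open>Bounds for the minimax and the Bayes risk\<close>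

text \<open>
  Only supports of size at most \<open>s\<close> enter the average. Discarding the others from the sum of the \<open>T S\<close>
  is harmless because these are non-negative with total one, so the loss is at most the
  constant 1.
\<close>

lemma minimax_risk_ge:
  assumes r: "0 < r" and \<eta>: "0 < \<eta>" "\<eta> < 1" and l: "0 < l"
    and bal: "l\<^sup>2 / 2 * (1 + 1 / r) = ln ((1 - \<eta>) / \<eta>)"
    and s: "real n * \<eta> < real s" and gain: "0 \<le> spike_gain r l"
    and X: "0 < X" "X \<le> spike_gain r l * (real n * \<eta> - real n * \<eta> * real s / (real s - real n * \<eta>)\<^sup>2) - 1"
  shows "ereal X \<le> minimax_risk n r (sparse_params n s)"
  unfolding minimax_risk_def
proof (rule INF_greatest)
  fix q assume q: "q \<in> pred_estimators n"
  let ?w = "support_weight n \<eta>" and ?g = "spike_gain r l"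
  let ?G = "{S. S \<subseteq> {..<n} \<and> card S \<le> s}"
  obtain T where T0: "\<And>S. S \<subseteq> {..<n} \<Longrightarrow> 0 \<le> T S"
    and T: "\<And>S. S \<subseteq> {..<n} \<Longrightarrow> ereal (?g * real (card S) + 1 - T S) \<le> kl_risk n r (spike_vector n l S) q"
    and T1: "(\<Sum>S\<in>Pow {..<n}. ?w S * T S) = 1"
    using kl_risk_spike_vector_ge[OF r \<eta> l bal q] by blast
  have w: "0 \<le> ?w S" for S using support_weight_pos[OF \<eta>, of n S] by simp
  have fin: "finite ?G" by (rule finite_subset[of _ "Pow {..<n}"]) auto
  let ?C = "SUP \<theta>\<in>sparse_params n s. kl_risk n r \<theta> q"
  have le: "ereal (?g * real (card S) + 1 - T S) \<le> ?C" if "S \<in> ?G" for S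
  proof -
    have "spike_vector n l S \<in> sparse_params n s"
    proof -
      have "spike_vector n l S \<in> Rn n" by (simp add: spike_vector_def)
      then show ?thesis
        using that spike_vector_support[of l S n] l by (simp add: sparse_params_def)
    qed
    then have "kl_risk n r (spike_vector n l S) q \<le> ?C" by (rule SUP_upper)
    then show ?thesis using that by (intro order_trans[OF T]) auto
  qed
  show "ereal X \<le> ?C"
  proof (cases "?C")
    case (real c)
    have le': "?g * real (card S) - T S \<le> c" if "S \<in> ?G" for S
      using le[OF that] unfolding real by simp
    have "X \<le> ?g * (\<Sum>S\<in>?G. ?w S * real (card S)) - 1"
      using X(2) mult_left_mono[OF truncated_mean_ge[OF \<eta> s] gain] by linarith
    also have "1 = (\<Sum>S\<in>Pow {..<n}. ?w S * T S)" by (simp add: T1)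
    also have "?g * (\<Sum>S\<in>?G. ?w S * real (card S)) - (\<Sum>S\<in>Pow {..<n}. ?w S * T S)
      \<le> ?g * (\<Sum>S\<in>?G. ?w S * real (card S)) - (\<Sum>S\<in>?G. ?w S * T S)"
      by (intro diff_left_mono sum_mono2 mult_nonneg_nonneg w T0) auto
    also have "\<dots> = (\<Sum>S\<in>?G. ?w S * (?g * real (card S) - T S))"
      unfolding sum_distrib_left sum_subtractf[symmetric] by (rule sum.cong) (simp_all add: algebra_simps)
    also have "\<dots> \<le> (\<Sum>S\<in>?G. ?w S * c)"
      by (intro sum_mono mult_left_mono w le')
    also have "\<dots> = (\<Sum>S\<in>?G. ?w S) * c" by (simp add: sum_distrib_right)
    finally have Xc: "X \<le> (\<Sum>S\<in>?G. ?w S) * c" .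
    have W: "0 \<le> (\<Sum>S\<in>?G. ?w S)" by (intro sum_nonneg w)
    have "(\<Sum>S\<in>?G. ?w S) \<le> (\<Sum>S\<in>Pow {..<n}. ?w S)" by (intro sum_mono2 w) auto
    then have W1: "(\<Sum>S\<in>?G. ?w S) \<le> 1" by (simp add: sum_support_weight)
    have "0 \<le> c"
    proof (rule ccontr)
      assume "\<not> 0 \<le> c"
      then have "(\<Sum>S\<in>?G. ?w S) * c \<le> 0" using W by (intro mult_nonneg_nonpos) auto
      with Xc X(1) show False by linarith
    qed
    then have "(\<Sum>S\<in>?G. ?w S) * c \<le> c" using W W1 by (simp add: mult_left_le_one_le)
    with Xc real show ?thesis by simp
  next
    case MInf
    then show ?thesis using le[of "{}"] by simp
  qed simp
qed

lemma spike_slab_estimator: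
  assumes r: "0 < r"
  shows "product_predictor n (spike_slab_predictor r l) \<in> pred_estimators n"
proof (rule product_predictor_in_pred_estimators)
  show "0 \<le> spike_slab_predictor r l x y" for x y
    using spike_slab_predictor_pos[OF r, of l x y] by simp
qed (rule spike_slab_predictor_measurable spike_slab_predictor_integral[OF r])+

lemma minimax_risk_le:
  assumes r: "0 < r" and l: "2 \<le> l"
  shows "minimax_risk n r (sparse_params n s) \<le> ereal (real n * (2 * exp 1 * exp (- l) * sqrt l)
        + real s * (l / (1 + r) + sqrt (2 * l) + ln (1 + 1 / r) / 2 + 2))"
  unfolding minimax_risk_def
proof (rule INF_lower2)
  let ?u0 = "2 * exp 1 * exp (- l) * sqrt l" and ?u1 = "l / (1 + r) + sqrt (2 * l) + ln (1 + 1 / r) / 2 + 2"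
  show "product_predictor n (spike_slab_predictor r l) \<in> pred_estimators n"
    by (rule spike_slab_estimator[OF r])
  show "(SUP \<theta>\<in>sparse_params n s. kl_risk n r \<theta> (product_predictor n (spike_slab_predictor r l)))
     \<le> ereal (real n * ?u0 + real s * ?u1)"
  proof (rule SUP_least)
    fix \<theta> assume "\<theta> \<in> sparse_params n s"
    then have "real (card {i. i < n \<and> \<theta> i \<noteq> 0}) \<le> real s" by (simp add: sparse_params_def)
    moreover have "0 \<le> ?u1" using r l by simp
    ultimately have "real (card {i. i < n \<and> \<theta> i \<noteq> 0}) * ?u1 \<le> real s * ?u1" by (rule mult_right_mono)
    then show "kl_risk n r \<theta> (product_predictor n (spike_slab_predictor r l)) \<le> ereal (real n * ?u0 + real s * ?u1)"
      by (intro order_trans[OF kl_risk_spike_slab_le[OF r l]]) simp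
  qed
qed

lemma bayes_risk_le:
  assumes r: "0 < r" and l: "2 \<le> l" and \<eta>: "0 \<le> \<eta>" "\<eta> \<le> 1" and "a \<noteq> 0"
  shows "bayes_risk n r (Pi\<^sub>M {..<n} (\<lambda>_. two_point_law \<eta> a)) \<le> ereal (real n * (2 * exp 1 * exp (- l) * sqrt l)
        + real n * \<eta> * (l / (1 + r) + sqrt (2 * l) + ln (1 + 1 / r) / 2 + 2))"
  unfolding bayes_risk_def
proof (rule INF_lower2)
  let ?u0 = "2 * exp 1 * exp (- l) * sqrt l" and ?u1 = "l / (1 + r) + sqrt (2 * l) + ln (1 + 1 / r) / 2 + 2"
  show "product_predictor n (spike_slab_predictor r l) \<in> pred_estimators n"
    by (rule spike_slab_estimator[OF r])
  have "(\<Sum>S\<in>Pow {..<n}. support_weight n \<eta> S * (real n * ?u0 + real (card S) * ?u1))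
      = (\<Sum>S\<in>Pow {..<n}. support_weight n \<eta> S) * (real n * ?u0)
       + (\<Sum>S\<in>Pow {..<n}. support_weight n \<eta> S * real (card S)) * ?u1"
    by (simp only: sum_distrib_right sum.distrib distrib_left mult.assoc)
  also have "\<dots> = real n * ?u0 + real n * \<eta> * ?u1"
    by (simp only: sum_support_weight sum_support_weight_card_id mult_1_left)
  finally have e: "(\<Sum>S\<in>Pow {..<n}. support_weight n \<eta> S * (real n * ?u0 + real (card S) * ?u1))
      = real n * ?u0 + real n * \<eta> * ?u1" .
  show "integrated_risk n r (Pi\<^sub>M {..<n} (\<lambda>_. two_point_law \<eta> a)) (product_predictor n (spike_slab_predictor r l))
     \<le> ereal (real n * ?u0 + real n * \<eta> * ?u1)"
    unfolding integrated_risk_def e[symmetric]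
  proof (rule ext_integral_iid_two_point(1)[OF \<eta> \<open>a \<noteq> 0\<close>])
    fix S assume "S \<subseteq> {..<n}"
    then show "kl_risk n r (spike_vector n a S) (product_predictor n (spike_slab_predictor r l))
        \<le> ereal (real n * ?u0 + real (card S) * ?u1)"
      using kl_risk_spike_slab_le[OF r l, of n "spike_vector n a S"] spike_vector_support[OF \<open>a \<noteq> 0\<close>]
      by (simp only:)
  qed
qed

lemma bayes_risk_ge:
  assumes r: "0 < r" and \<eta>: "0 < \<eta>" "\<eta> < 1" and l: "0 < l"
    and bal: "l\<^sup>2 / 2 * (1 + 1 / r) = ln ((1 - \<eta>) / \<eta>)"
  shows "ereal (spike_gain r l * (real n * \<eta>)) \<le> bayes_risk n r (Pi\<^sub>M {..<n} (\<lambda>_. two_point_law \<eta> l))"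
  unfolding bayes_risk_def
proof (rule INF_greatest)
  fix q assume q: "q \<in> pred_estimators n"
  let ?w = "support_weight n \<eta>" and ?g = "spike_gain r l"
  obtain T where T: "\<And>S. S \<subseteq> {..<n} \<Longrightarrow> ereal (?g * real (card S) + 1 - T S) \<le> kl_risk n r (spike_vector n l S) q"
    and T1: "(\<Sum>S\<in>Pow {..<n}. ?w S * T S) = 1"
    using kl_risk_spike_vector_ge[OF r \<eta> l bal q] by blast
  have "(\<Sum>S\<in>Pow {..<n}. ?w S * (?g * real (card S) + 1 - T S))
      = ?g * (\<Sum>S\<in>Pow {..<n}. ?w S * real (card S)) + (\<Sum>S\<in>Pow {..<n}. ?w S) - (\<Sum>S\<in>Pow {..<n}. ?w S * T S)"
    by (simp add: sum_distrib_left sum.distrib sum_subtractf distrib_left right_diff_distrib mult_ac)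
  then have "?g * (real n * \<eta>) = (\<Sum>S\<in>Pow {..<n}. ?w S * (?g * real (card S) + 1 - T S))"
    by (simp add: T1 sum_support_weight sum_support_weight_card_id)
  then show "ereal (?g * (real n * \<eta>)) \<le> integrated_risk n r (Pi\<^sub>M {..<n} (\<lambda>_. two_point_law \<eta> l)) q"
    unfolding integrated_risk_def using \<eta> l T
    by (simp only:) (rule ext_integral_iid_two_point(2); simp)
qed

section \<open>Asymptotics\<close>

lemma asymptotic_ratio:
  fixes R B :: "nat \<Rightarrow> ereal" and A lo hi :: "nat \<Rightarrow> real"
  assumes lo: "lo \<longlonglongrightarrow> 1" and hi: "hi \<longlonglongrightarrow> 1"
    and ev: "\<forall>\<^sub>F n in sequentially. 0 < A n \<and> ereal (A n * lo n) \<le> R n \<and> R n \<le> ereal (A n * hi n)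
      \<and> ereal (A n * lo n) \<le> B n \<and> B n \<le> ereal (A n * hi n)"
  shows "\<exists>\<epsilon> :: nat \<Rightarrow> real. \<epsilon> \<longlonglongrightarrow> 0 \<and>
    (\<forall>\<^sub>F n in sequentially. \<bar>R n\<bar> \<noteq> \<infinity> \<and> B n = R n * ereal (1 + \<epsilon> n))"
proof -
  define a b where "a n = real_of_ereal (R n) / A n" and "b n = real_of_ereal (B n) / A n" for n
  have squeeze: "x = ereal (real_of_ereal x) \<and> l \<le> real_of_ereal x / c \<and> real_of_ereal x / c \<le> u"
    if "0 < c" "ereal (c * l) \<le> x" "x \<le> ereal (c * u)" for x :: ereal and c l u :: real
    using that by (cases x) (auto simp: field_simps)
  have R: "\<forall>\<^sub>F n in sequentially. R n = ereal (real_of_ereal (R n)) \<and> lo n \<le> a n \<and> a n \<le> hi n"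
    using ev unfolding a_def by (rule eventually_mono) (intro squeeze; simp)
  have B: "\<forall>\<^sub>F n in sequentially. B n = ereal (real_of_ereal (B n)) \<and> lo n \<le> b n \<and> b n \<le> hi n"
    using ev unfolding b_def by (rule eventually_mono) (intro squeeze; simp)
  have a1: "a \<longlonglongrightarrow> 1"
    by (rule tendsto_sandwich[OF _ _ lo hi]; rule eventually_mono[OF R]; simp)
  have b1: "b \<longlonglongrightarrow> 1"
    by (rule tendsto_sandwich[OF _ _ lo hi]; rule eventually_mono[OF B]; simp)
  show ?thesis
  proof (intro exI conjI)
    show "(\<lambda>n. b n / a n - 1) \<longlonglongrightarrow> 0"
      using tendsto_diff[OF tendsto_divide[OF b1 a1] tendsto_const[of 1]] by simp
    have "\<forall>\<^sub>F n in sequentially. 0 < a n" using order_tendstoD(1)[OF a1, of 0] by simp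
    with R B ev show "\<forall>\<^sub>F n in sequentially. \<bar>R n\<bar> \<noteq> \<infinity> \<and> B n = R n * ereal (1 + (b n / a n - 1))"
    proof eventually_elim
      case (elim n)
      then have A: "A n \<noteq> 0" "a n \<noteq> 0" by auto
      have "real_of_ereal (B n) = real_of_ereal (R n) * (b n / a n)"
        using A by (simp add: a_def b_def)
      moreover have B: "B n = ereal (real_of_ereal (B n))" using elim by blast
      ultimately have "B n = ereal (real_of_ereal (R n) * (b n / a n))" by simp
      moreover have "R n = ereal (real_of_ereal (R n))" using elim by blast
      ultimately show ?case by (cases "R n") auto
    qed
  qed
qed

definition log_odds :: "real \<Rightarrow> real" where
  "log_odds \<eta> = ln ((1 - \<eta>) / \<eta>)"

lemma lambda_f_log_odds: "lambda_f r \<eta> = sqrt (v_w r) * (sqrt 2 * sqrt (log_odds \<eta>))"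
  by (simp add: lambda_f_def lambda_e_def log_odds_def inverse_eq_divide real_sqrt_mult)

lemma v_w_pos: "0 < r \<Longrightarrow> 0 < v_w r"
  by (simp add: v_w_def add_pos_pos)

lemma lambda_f_pos: "0 < r \<Longrightarrow> 0 < log_odds \<eta> \<Longrightarrow> 0 < lambda_f r \<eta>"
  by (simp add: lambda_f_log_odds v_w_pos)

lemma lambda_f_square:
  assumes "0 < r" "0 \<le> log_odds \<eta>"
  shows "(lambda_f r \<eta>)\<^sup>2 = v_w r * 2 * log_odds \<eta>"
  using assms v_w_pos[of r] by (simp add: lambda_f_log_odds power_mult_distrib)

lemma lambda_f_balance:
  assumes "0 < r" "0 \<le> log_odds \<eta>"
  shows "(lambda_f r \<eta>)\<^sup>2 / 2 * (1 + 1 / r) = ln ((1 - \<eta>) / \<eta>)"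
proof -
  have "v_w r * (1 + 1 / r) = 1"
    using assms by (simp add: v_w_def inverse_eq_divide add_pos_pos[THEN less_imp_neq[THEN not_sym]])
  then show ?thesis
    unfolding lambda_f_square[OF assms] log_odds_def[symmetric] by simp
qed

definition gain_cost :: "real \<Rightarrow> real" where
  "gain_cost r = sqrt (v_w r) * sqrt 2 * (1 + 1 / sqrt r)"

text \<open>
  The constant \<open>1 / (1 + r)\<close> arises as \<open>v\<^sub>w / r\<close>.
\<close>

lemma spike_gain_lambda_f:
  assumes "0 < r" "0 \<le> log_odds \<eta>"
  shows "spike_gain r (lambda_f r \<eta>)
    = log_odds \<eta> / (1 + r) - gain_cost r * sqrt (log_odds \<eta>) - ln 2"
proof -
  have "v_w r / r = 1 / (1 + r)"
    using assms by (simp add: v_w_def inverse_eq_divide divide_simps)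
  then have "(lambda_f r \<eta>)\<^sup>2 / (2 * r) = log_odds \<eta> / (1 + r)"
  proof -
    have "v_w r * 2 * log_odds \<eta> / (2 * r) = v_w r / r * log_odds \<eta>" using assms by simp
    with \<open>v_w r / r = 1 / (1 + r)\<close> show ?thesis unfolding lambda_f_square[OF assms] by simp
  qed
  then show ?thesis
    unfolding spike_gain_def by (simp add: lambda_f_log_odds gain_cost_def algebra_simps)
qed

text \<open>
  Lets the bound for the smaller sparsity \<open>\<eta>'\<close> be replaced by the one for \<open>\<eta>\<close>: the function
  \<open>k t - c \<surd>t\<close> increases once \<open>c \<le> 2 k \<surd>t\<close>.
\<close>

lemma gain_mono:
  fixes k c t t' :: real
  assumes "0 < t" "t \<le> t'" "0 \<le> c" "c \<le> k * sqrt t"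
  shows "k * t - c * sqrt t \<le> k * t' - c * sqrt t'"
proof -
  have s: "0 < sqrt t" "sqrt t \<le> sqrt t'" "t = sqrt t * sqrt t" "t' = sqrt t' * sqrt t'"
    using assms by auto
  have k: "0 \<le> k" using assms(3,4) s(1) by (metis mult_neg_pos not_le order_trans)
  have "0 \<le> (sqrt t' - sqrt t) * (k * (sqrt t' + sqrt t) - c)"
  proof (rule mult_nonneg_nonneg)
    have "k * sqrt t \<le> k * (sqrt t' + sqrt t)" using k s by (intro mult_left_mono) auto
    then show "0 \<le> k * (sqrt t' + sqrt t) - c" using assms by linarith
  qed (use s in simp)
  also have "\<dots> = k * (sqrt t' * sqrt t') - c * sqrt t' - (k * (sqrt t * sqrt t) - c * sqrt t)"
    by (simp add: algebra_simps)
  finally show ?thesis using s(3,4) by simp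
qed

lemma log_odds_antimono:
  assumes "0 < \<eta>'" "\<eta>' \<le> \<eta>" "\<eta> < 1"
  shows "log_odds \<eta> \<le> log_odds \<eta>'"
proof -
  have "(1 - \<eta>) / \<eta> \<le> (1 - \<eta>') / \<eta>'" using assms by (intro frac_le) auto
  then show ?thesis unfolding log_odds_def using assms by (intro ln_mono) auto
qed

lemma log_odds_at_top:
  assumes "f \<longlonglongrightarrow> 0" "\<forall>\<^sub>F n in sequentially. 0 < f n"
  shows "filterlim (\<lambda>n. log_odds (f n)) at_top sequentially"
proof -
  have "filterlim (\<lambda>n. - 1 + inverse (f n)) at_top sequentially"
    by (intro filterlim_tendsto_add_at_top[OF tendsto_const] filterlim_inverse_at_top assms)
  then have "filterlim (\<lambda>n. ln (- 1 + inverse (f n))) at_top sequentially"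
    by (rule filterlim_compose[OF ln_at_top])
  moreover have "\<forall>\<^sub>F n in sequentially. ln (- 1 + inverse (f n)) = log_odds (f n)"
    using assms(2) by eventually_elim (simp add: log_odds_def inverse_eq_divide diff_divide_distrib)
  ultimately show ?thesis by (rule filterlim_cong[OF refl refl, THEN iffD1, rotated])
qed

text \<open>
  The common first-order value of the two risks.
\<close>

definition rate :: "real \<Rightarrow> nat \<Rightarrow> nat \<Rightarrow> real" where
  "rate r n s = real s * log_odds (real s / real n) / (1 + r)"

text \<open>
  As \<open>exp (- l) = \<eta> / (1 - \<eta>) \<le> 2 \<eta>\<close>, the \<open>n\<close> null coordinates contribute at most \<open>4 e s \<surd>l\<close>.
\<close>

lemma spike_slab_total_le:
  assumes r: "0 < r" and s: "1 \<le> s" "s \<le> n" and half: "real s / real n \<le> 1 / 2"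
    and L: "2 \<le> log_odds (real s / real n)"
  defines "l \<equiv> log_odds (real s / real n)"
  shows "real n * (2 * exp 1 * exp (- l) * sqrt l) + real s * (l / (1 + r) + sqrt (2 * l) + ln (1 + 1 / r) / 2 + 2)
    \<le> rate r n s * (1 + (1 + r) * (4 * exp 1 + sqrt 2) * inverse (sqrt l)
        + (1 + r) * (ln (1 + 1 / r) / 2 + 2) * (inverse (sqrt l))\<^sup>2)"
proof -
  let ?\<eta> = "real s / real n" and ?v = "sqrt l" and ?c = "ln (1 + 1 / r) / 2 + 2"
  have \<eta>: "0 < ?\<eta>" "?\<eta> \<le> 1 / 2" using s half by auto
  have l: "2 \<le> l" using L by (simp add: l_def)
  have v: "0 < ?v" "l = ?v * ?v" using l by auto
  have "exp (- l) = ?\<eta> / (1 - ?\<eta>)"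
  proof -
    have "0 < (1 - ?\<eta>) / ?\<eta>" by (rule divide_pos_pos) (use \<eta> in linarith)+
    then have "exp l = (1 - ?\<eta>) / ?\<eta>" unfolding l_def log_odds_def by (rule exp_ln)
    then show ?thesis by (simp add: exp_minus)
  qed
  also have "\<dots> \<le> ?\<eta> / (1 / 2)"
    by (intro divide_left_mono mult_pos_pos) (use \<eta> in linarith)+
  finally have "exp (- l) \<le> 2 * ?\<eta>" by (simp add: mult.commute)
  then have "real n * exp (- l) \<le> real n * (2 * ?\<eta>)" by (intro mult_left_mono) auto
  also have "\<dots> = 2 * real s" using s by simp
  finally have "real n * exp (- l) * (2 * exp 1 * ?v) \<le> 2 * real s * (2 * exp 1 * ?v)"
    using v by (intro mult_right_mono) auto
  then have "real n * (2 * exp 1 * exp (- l) * ?v) + real s * (l / (1 + r) + sqrt (2 * l) + ?c)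
     \<le> real s * (4 * exp 1 * ?v + l / (1 + r) + sqrt 2 * ?v + ?c)"
    by (simp add: algebra_simps real_sqrt_mult)
  also have "\<dots> = real s * (?v * ?v) / (1 + r) * (1 + (1 + r) * (4 * exp 1 + sqrt 2) * inverse ?v
      + (1 + r) * ?c * (inverse ?v)\<^sup>2)"
  proof -
    define d where "d = 1 + r"
    define e where "e = exp (1::real)"
    have "0 < d" using r by (simp add: d_def)
    have ident: "4 * e * w + w * w / d + sqrt 2 * w + ?c = w * w / d * (1 + d * (4 * e + sqrt 2) * inverse w + d * ?c * (inverse w)\<^sup>2)"
      if "0 < w" for w
    proof -
      have "w * w / d * (1 + d * (4 * e + sqrt 2) * inverse w + d * ?c * (inverse w)\<^sup>2)
        = w * w / d + (w * inverse w) * (d / d) * w * (4 * e + sqrt 2) + (w * inverse w)\<^sup>2 * (d / d) * ?c"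
        by (simp add: distrib_left power2_eq_square mult_ac)
      also have "\<dots> = 4 * e * w + w * w / d + sqrt 2 * w + ?c"
        using \<open>0 < d\<close> that by (simp add: algebra_simps)
      finally show ?thesis by simp
    qed
    let ?Z = "1 + d * (4 * e + sqrt 2) * inverse ?v + d * ?c * (inverse ?v)\<^sup>2"
    have "real s * (4 * e * ?v + l / d + sqrt 2 * ?v + ?c) = real s * (4 * e * ?v + ?v * ?v / d + sqrt 2 * ?v + ?c)"
      by (simp only: v(2)[symmetric])
    also have "\<dots> = real s * (?v * ?v / d * ?Z)"
      by (simp only: ident[OF v(1)])
    also have "\<dots> = real s * (?v * ?v) / d * ?Z"
      by (simp only: times_divide_eq_right times_divide_eq_left mult.assoc)
    finally show ?thesis unfolding d_def e_def .
  qed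
  finally show ?thesis using v(2) by (simp add: rate_def l_def add.assoc)
qed

text \<open>
  The ratio of \<^const>\<open>spike_gain\<close> at \<open>\<lambda>\<^sub>f\<close> to its leading term \<open>l / (1 + r)\<close>, with \<open>l\<close> the log odds.
\<close>

definition gain_factor :: "real \<Rightarrow> real \<Rightarrow> real" where
  "gain_factor r l = 1 - (1 + r) * ln 2 * (inverse (sqrt l))\<^sup>2 - (1 + r) * gain_cost r * inverse (sqrt l)"

lemma gain_cost_nonneg: "0 < r \<Longrightarrow> 0 \<le> gain_cost r"
  using v_w_pos[of r] by (simp add: gain_cost_def)

lemma spike_gain_eq_gain_factor:
  assumes r: "0 < r" and L: "0 < log_odds \<eta>"
  shows "spike_gain r (lambda_f r \<eta>) = log_odds \<eta> / (1 + r) * gain_factor r (log_odds \<eta>)"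
proof -
  define w d where "w = sqrt (log_odds \<eta>)" and "d = 1 + r"
  have w: "0 < w" "log_odds \<eta> = w * w" using L by (auto simp: w_def)
  have d: "0 < d" using r by (simp add: d_def)
  have "w * w / d * (1 - d * ln 2 * (inverse w)\<^sup>2 - d * gain_cost r * inverse w) = w * w / d - gain_cost r * w - ln 2"
    using w(1) d by (simp add: power2_eq_square field_simps)
  then show ?thesis
    using spike_gain_lambda_f[OF r, of \<eta>] L w(2)
    unfolding gain_factor_def w_def[symmetric] d_def[symmetric] by simp
qed

lemma bayes_risk_iid_prior_ge:
  assumes r: "0 < r" and s: "1 \<le> s" "s \<le> n" and lt: "real s / real n < 1"
    and L: "0 < log_odds (real s / real n)"
  shows "ereal (rate r n s * gain_factor r (log_odds (real s / real n)))
    \<le> bayes_risk n r (iid_prior n r (real s / real n))"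
proof -
  let ?\<eta> = "real s / real n"
  have "ereal (spike_gain r (lambda_f r ?\<eta>) * (real n * ?\<eta>)) \<le> bayes_risk n r (iid_prior n r ?\<eta>)"
    unfolding iid_prior_def
    using s L by (intro bayes_risk_ge r lt lambda_f_pos lambda_f_balance) auto
  moreover have "spike_gain r (lambda_f r ?\<eta>) * (real n * ?\<eta>)
      = rate r n s * gain_factor r (log_odds ?\<eta>)"
    using s unfolding spike_gain_eq_gain_factor[OF r L] rate_def by simp
  ultimately show ?thesis by simp
qed

text \<open>
  The prior uses \<open>\<eta>' = (1 - 1 / u) \<eta>\<close> with \<open>u = s\<^bsup>1/4\<^esup>\<close>: the expected support size \<open>s (1 - 1 / u)\<close> stays
  asymptotic to \<open>s\<close>, while the gap \<open>s / u = s\<^bsup>3/4\<^esup>\<close> exceeds the standard deviation, which is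
  at most \<open>\<surd>s\<close>, so that the truncation costs no more than \<open>u\<^sup>2 = \<surd>s\<close>.
\<close>

lemma minimax_risk_sparse_ge:
  fixes u :: real
  assumes r: "0 < r" and s: "1 \<le> s" "s \<le> n" and lt: "real s / real n < 1"
    and L: "0 < log_odds (real s / real n)" and G: "0 \<le> gain_factor r (log_odds (real s / real n))"
    and u: "u = sqrt (sqrt (real s))" "2 \<le> u"
  defines "l \<equiv> log_odds (real s / real n)"
  defines "low \<equiv> gain_factor r l * (1 - inverse u - (inverse u)\<^sup>2) - (1 + r) * inverse u ^ 4 * (inverse (sqrt l))\<^sup>2"
  assumes low: "0 < low"
  shows "ereal (rate r n s * low) \<le> minimax_risk n r (sparse_params n s)"
proof -
  let ?\<eta> = "real s / real n"
  define \<eta>' where "\<eta>' = (1 - inverse u) * ?\<eta>"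
  have iu: "0 < inverse u" "inverse u \<le> 1 / 2" using u(2) by (auto simp: inverse_eq_divide field_simps)
  have \<eta>: "0 < ?\<eta>" using s by simp
  have \<eta>': "0 < \<eta>'" "\<eta>' \<le> ?\<eta>" "\<eta>' < 1"
  proof -
    show "0 < \<eta>'" unfolding \<eta>'_def using iu \<eta> by (intro mult_pos_pos) auto
    show "\<eta>' \<le> ?\<eta>" unfolding \<eta>'_def using iu \<eta> by (intro mult_left_le_one_le) auto
    then show "\<eta>' < 1" using lt by linarith
  qed
  have l0: "0 < l" using L by (simp add: l_def)
  have ll: "l \<le> log_odds \<eta>'" unfolding l_def by (rule log_odds_antimono[OF \<eta>'(1,2) lt])
  then have L': "0 < log_odds \<eta>'" using l0 by linarith
  have us: "real s = u ^ 4"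
  proof -
    have "u ^ 4 = (u\<^sup>2)\<^sup>2" by simp
    also have "\<dots> = real s" unfolding u(1) by simp
    finally show ?thesis by simp
  qed
  have n\<eta>': "real n * \<eta>' = real s * (1 - inverse u)" using s by (simp add: \<eta>'_def)
  let ?g = "spike_gain r (lambda_f r ?\<eta>)" and ?g' = "spike_gain r (lambda_f r \<eta>')"
  have g: "?g = l / (1 + r) * gain_factor r l"
    using spike_gain_eq_gain_factor[OF r L] by (simp add: l_def)
  have g0: "0 \<le> ?g" unfolding g using r l0 G by (simp add: l_def)
  have gg: "?g \<le> ?g'"
  proof -
    have c: "gain_cost r \<le> 1 / (1 + r) * sqrt l"
    proof -
      have "0 \<le> (1 + r) * ln 2 * (inverse (sqrt l))\<^sup>2" using r by simp
      then have "(1 + r) * gain_cost r * inverse (sqrt l) \<le> 1"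
        using G unfolding gain_factor_def l_def by linarith
      then show ?thesis using r l0 by (simp add: field_simps)
    qed
    have "1 / (1 + r) * l - gain_cost r * sqrt l \<le> 1 / (1 + r) * log_odds \<eta>' - gain_cost r * sqrt (log_odds \<eta>')"
      by (rule gain_mono[OF l0 ll gain_cost_nonneg[OF r] c])
    then show ?thesis
      using spike_gain_lambda_f[OF r, of ?\<eta>] spike_gain_lambda_f[OF r, of \<eta>'] L L' by (simp add: l_def)
  qed
  \<comment> \<open>this rewrites the additive constant 1 of \<open>minimax_risk_ge\<close> as a multiple of the rate\<close>
  have one: "rate r n s * ((1 + r) * inverse u ^ 4 * (inverse (sqrt l))\<^sup>2) = 1"
  proof -
    have "(inverse (sqrt l))\<^sup>2 = inverse l" using l0 by (simp add: power_inverse)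
    moreover have "rate r n s = u ^ 4 * l / (1 + r)" by (simp only: rate_def l_def us[symmetric])
    ultimately show ?thesis using r l0 u(2) by (simp add: power_inverse field_simps)
  qed
  have X: "rate r n s * low = ?g * (real s * (1 - inverse u - (inverse u)\<^sup>2)) - 1"
    unfolding low_def right_diff_distrib[of "rate r n s"] one g by (simp add: rate_def l_def)
  have cheb: "real s * (1 - inverse u - (inverse u)\<^sup>2)
      \<le> real n * \<eta>' - real n * \<eta>' * real s / (real s - real n * \<eta>')\<^sup>2"
  proof -
    have "real s - real n * \<eta>' = real s * inverse u" unfolding n\<eta>' by (simp add: algebra_simps)
    then have "real n * \<eta>' * real s / (real s - real n * \<eta>')\<^sup>2 = (1 - inverse u) * u\<^sup>2"
      unfolding n\<eta>' using s u(2) by (simp add: power2_eq_square field_simps)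
    also have "\<dots> \<le> u\<^sup>2" using iu by (intro mult_left_le_one_le) auto
    also have "\<dots> = real s * (inverse u)\<^sup>2"
      unfolding us using u(2) by (simp add: power2_eq_square power4_eq_xxxx field_simps)
    finally show ?thesis unfolding n\<eta>' by (simp add: right_diff_distrib)
  qed
  have q: "0 \<le> real s * (1 - inverse u - (inverse u)\<^sup>2)"
  proof -
    have "(inverse u)\<^sup>2 \<le> (1 / 2)\<^sup>2" using iu by (intro power_mono) auto
    then show ?thesis using iu by (intro mult_nonneg_nonneg) (auto simp: power2_eq_square)
  qed
  show ?thesis
  proof (rule minimax_risk_ge[where \<eta> = \<eta>' and l = "lambda_f r \<eta>'"])
    show "0 < rate r n s * low"
      using low r s L by (intro mult_pos_pos) (auto simp: rate_def)
    have "?g * (real s * (1 - inverse u - (inverse u)\<^sup>2)) \<le>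
        ?g' * (real n * \<eta>' - real n * \<eta>' * real s / (real s - real n * \<eta>')\<^sup>2)"
      using gg g0 cheb q by (intro mult_mono) auto
    then show "rate r n s * low \<le> ?g' * (real n * \<eta>' - real n * \<eta>' * real s / (real s - real n * \<eta>')\<^sup>2) - 1"
      unfolding X by linarith
    show "real n * \<eta>' < real s" unfolding n\<eta>' using s iu by simp
    show "0 \<le> ?g'" using g0 gg by linarith
  qed (use r \<eta>' L' lambda_f_pos lambda_f_balance in auto)
qed

theorem mainTheorem2:
  fixes r :: real and s :: "nat \<Rightarrow> nat"
  assumes "0 < r"
    and "\<And>n. 1 \<le> n \<Longrightarrow> 1 \<le> s n \<and> s n \<le> n"
    and "filterlim s at_top sequentially"
    and "(\<lambda>n. real (s n) / real n) \<longlonglongrightarrow> 0"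
  shows "\<exists>\<epsilon> :: nat \<Rightarrow> real. \<epsilon> \<longlonglongrightarrow> 0 \<and>
    (\<forall>\<^sub>F n in sequentially.
       \<bar>minimax_risk n r (sparse_params n (s n))\<bar> \<noteq> \<infinity> \<and>
       bayes_risk n r (iid_prior n r (real (s n) / real n)) =
         minimax_risk n r (sparse_params n (s n)) * ereal (1 + \<epsilon> n))"
proof -
  note r = assms(1)
  define l where "l n = log_odds (real (s n) / real n)" for n
  define u where "u n = sqrt (sqrt (real (s n)))" for n
  define lo where "lo n = gain_factor r (l n) * (1 - inverse (u n) - (inverse (u n))\<^sup>2)
    - (1 + r) * inverse (u n) ^ 4 * (inverse (sqrt (l n)))\<^sup>2" for n
  define hi where "hi n = 1 + (1 + r) * (4 * exp 1 + sqrt 2) * inverse (sqrt (l n))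
    + (1 + r) * (ln (1 + 1 / r) / 2 + 2) * (inverse (sqrt (l n)))\<^sup>2" for n
  have n1: "\<forall>\<^sub>F n in sequentially. 1 \<le> n" by (rule eventually_ge_at_top)
  have l_top: "filterlim l at_top sequentially"
    unfolding l_def using assms(2)
    by (intro log_odds_at_top assms(4) eventually_mono[OF n1]) force
  have u_top: "filterlim u at_top sequentially"
    unfolding u_def
    by (intro filterlim_compose[OF sqrt_at_top] filterlim_compose[OF filterlim_real_sequentially] assms(3))
  have iv: "(\<lambda>n. inverse (sqrt (l n))) \<longlonglongrightarrow> 0"
    by (intro tendsto_inverse_0_at_top filterlim_compose[OF sqrt_at_top] l_top)
  have iu: "(\<lambda>n. inverse (u n)) \<longlonglongrightarrow> 0"
    by (intro tendsto_inverse_0_at_top u_top)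
  have G1: "(\<lambda>n. gain_factor r (l n)) \<longlonglongrightarrow> 1"
    unfolding gain_factor_def by (rule tendsto_eq_intros iv refl | simp)+
  have lo: "lo \<longlonglongrightarrow> 1"
    unfolding lo_def by (rule tendsto_eq_intros G1 iv iu refl | simp)+
  have hi: "hi \<longlonglongrightarrow> 1"
    unfolding hi_def by (rule tendsto_eq_intros iv refl | simp)+
  have "\<forall>\<^sub>F n in sequentially. 0 < rate r n (s n) \<and>
      ereal (rate r n (s n) * lo n) \<le> minimax_risk n r (sparse_params n (s n)) \<and>
      minimax_risk n r (sparse_params n (s n)) \<le> ereal (rate r n (s n) * hi n) \<and>
      ereal (rate r n (s n) * lo n) \<le> bayes_risk n r (iid_prior n r (real (s n) / real n)) \<and>
      bayes_risk n r (iid_prior n r (real (s n) / real n)) \<le> ereal (rate r n (s n) * hi n)"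
    using n1 order_tendstoD(2)[OF assms(4), of "1 / 2", simplified]
      filterlim_at_top[THEN iffD1, OF l_top, rule_format, of 2]
      filterlim_at_top[THEN iffD1, OF u_top, rule_format, of 2]
      order_tendstoD(1)[OF lo, of 0, simplified] order_tendstoD(1)[OF G1, of 0, simplified]
  proof eventually_elim
    case (elim n)
    let ?\<eta> = "real (s n) / real n"
    have s: "1 \<le> s n" "s n \<le> n" using assms(2)[OF elim(1)] by auto
    have half: "?\<eta> \<le> 1 / 2" "?\<eta> < 1" and \<eta>0: "0 \<le> ?\<eta>"
    proof -
      have "?\<eta> < 1 / 2" using elim(2) by simp
      then show "?\<eta> \<le> 1 / 2" "?\<eta> < 1" by linarith+
    qed simp
    have L: "2 \<le> log_odds ?\<eta>" "0 < log_odds ?\<eta>" using elim(3) by (auto simp: l_def)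
    have rate: "0 < rate r n (s n)" using r s L by (simp add: rate_def)
    have G: "0 \<le> gain_factor r (log_odds ?\<eta>)" using elim(6) by (simp add: l_def)
    have R_ge: "ereal (rate r n (s n) * lo n) \<le> minimax_risk n r (sparse_params n (s n))"
      using minimax_risk_sparse_ge[OF r s half(2) L(2) G u_def elim(4)] elim(5)
      by (simp add: lo_def l_def)
    have "lo n \<le> gain_factor r (l n) * (1 - inverse (u n) - (inverse (u n))\<^sup>2)"
      using r by (simp add: lo_def)
    also have "\<dots> \<le> gain_factor r (l n) * 1"
    proof (rule mult_left_mono)
      have "0 \<le> inverse (u n)" "0 \<le> (inverse (u n))\<^sup>2" using elim(4) by auto
      then show "1 - inverse (u n) - (inverse (u n))\<^sup>2 \<le> 1" by linarith
    qed (use elim(6) in simp)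
    finally have "rate r n (s n) * lo n \<le> rate r n (s n) * gain_factor r (l n)"
      using rate by (intro mult_left_mono) auto
    then have B_ge: "ereal (rate r n (s n) * lo n) \<le> bayes_risk n r (iid_prior n r ?\<eta>)"
      by (intro order_trans[OF _ bayes_risk_iid_prior_ge[OF r s half(2) L(2)]]) (simp add: l_def)
    note total = spike_slab_total_le[OF r s half(1) L(1), folded l_def, folded hi_def]
    have R_le: "minimax_risk n r (sparse_params n (s n)) \<le> ereal (rate r n (s n) * hi n)"
      using total L(1) by (intro order_trans[OF minimax_risk_le[OF r, of "l n"]]) (auto simp: l_def)
    have "lambda_f r ?\<eta> \<noteq> 0" using lambda_f_pos[OF r L(2)] by simp
    then have "bayes_risk n r (iid_prior n r ?\<eta>) \<le> ereal (real n * (2 * exp 1 * exp (- l n) * sqrt (l n))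
        + real n * ?\<eta> * (l n / (1 + r) + sqrt (2 * l n) + ln (1 + 1 / r) / 2 + 2))"
      unfolding iid_prior_def
      using L(1) \<eta>0 half(2) by (intro bayes_risk_le r) (auto simp: l_def)
    also have "real n * ?\<eta> = real (s n)" using s by simp
    finally have B_le: "bayes_risk n r (iid_prior n r ?\<eta>) \<le> ereal (rate r n (s n) * hi n)"
      by (rule order_trans) (use total in simp)
    from rate R_ge R_le B_ge B_le show ?case by blast
  qed
  from asymptotic_ratio[OF lo hi this] show ?thesis .
qed

end
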